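(* Let $\mathcal{W}_S$ be a Coxeter group of type $A_n$ ($n\ge 1$), $B_n$ ($n\ge 2$) or $I_2(k)$ ($k\ge 2$ an integer), with associated generalized braid group $\mathcal{A}_S$. Then for some $m$ there exist an injective group homomorphism $e:\mathcal{W}_S\to S_m$ and a group homomorphism $f_S:\mathcal{A}_S\to\mathcal{A}_m$ making the following diagram with exact rows commutative: $$\begin{array}{ccccccccc} 1 & \to & \mathcal{PA}_S & \to & \mathcal{A}_S & \xrightarrow{\pi_S} & \mathcal{W}_S & \to & 1\\ & & \downarrow & & \downarrow & & \downarrow & & \\ 1 & \to & \mathcal{PA}_m & \to & \mathcal{A}_m & \xrightarrow{\pi_m} & S_m & \to & 1 \end{array}$$ where the vertical maps are, from left to right, $f_S|_{\mathcal{PA}_S}$, $f_S$ and $e$. That is, $\pi_m\circ f_S=e\circ\pi_S$ (and hence $f_S(\mathcal{PA}_S)\subseteq\mathcal{PA}_m$).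
   Context: Let $S$ be a finite set and $m:S\times S\to\{1,2,\dots,\infty\}$ a symmetric function with $m(s,s)=1$ and $m(s,s')\ge 2$ for $s\ne s'$. The Coxeter group of $(S,m)$ is $\mathcal{W}_S=\langle S\mid (ss')^{m(s,s')}=1,\ s,s'\in S\rangle$ (no relation if $m(s,s')=\infty$). The associated generalized braid group is $\mathcal{A}_S=\langle S\mid ss'ss'\cdots=s'ss's\cdots,\ s\neq s'\in S\rangle$, where each side is an alternating word with $m(s,s')$ factors. The map $\pi_S:\mathcal{A}_S\to\mathcal{W}_S$ is the surjective homomorphism that is the identity on the generators, and $\mathcal{PA}_S=\ker\pi_S$ is the pure braid group. Types: - Type $A_n$: $\mathcal{W}_S$ is the symmetric group $S_{n+1}$ with its standard Coxeter presentation: generators $s_1,\dots,s_n$, with $m(s_i,s_{i+1})=3$ and $m(s_i,s_j)=2$ for $|i-j|\ge2$. - Type $B_n$: generators $s_1,\dots,s_n$, with $m(s_1,s_2)=4$, $m(s_i,s_{i+1})=3$ for $i\ge 2$, and $m(s_i,s_j)=2$ for $|i-j|\ge 2$. - Type $I_2(k)$: generators $s_1,s_2$, with $m(s_1,s_2)=k$. The symmetric group on $m$ letters is denoted $S_m$. The classical Artin braid group is $\mathcal{A}_m=\langle \sigma_1,\dots,\sigma_{m-1}\mid \sigma_i\sigma_j=\sigma_j\sigma_i \text{ for } |i-j|\ge 2,\ \sigma_i\sigma_{i+1}\sigma_i=\sigma_{i+1}\sigma_i\sigma_{i+1}\text{ for } i\le m-2\rangle$. The surjective homomorphism $\pi_m:\mathcal{A}_m\to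 S_m$ sends $\sigma_i$ to the transposition $(i,i+1)$, and $\mathcal{PA}_m=\ker\pi_m$. *)

theory Defs
  imports "HOL-Algebra.Sym_Groups" "HOL-Algebra.Exact_Sequence" "HOL-Library.Extended_Nat" "HOL-Combinatorics.Transposition"
begin

section \<open>Groups given by generators and relations\<close>

text \<open>The letter \<^term>\<open>(s, True)\<close> stands for the generator \<^term>\<open>s\<close> and
  \<^term>\<open>(s, False)\<close> for its formal inverse.\<close>

type_synonym 'a word = "('a \<times> bool) list"

abbreviation words :: "'a set \<Rightarrow> 'a word set"
  where "words S \<equiv> lists (S \<times> UNIV)"

text \<open>A relation \<open>l = r\<close> is a pair \<^term>\<open>(l, r)\<close> of words. The following is the congruence on
  words generated by free cancellation and by the relations in \<open>R\<close>.\<close>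

inductive pres_eq :: "'a set \<Rightarrow> ('a word \<times> 'a word) set \<Rightarrow> 'a word \<Rightarrow> 'a word \<Rightarrow> bool"
  for S R where
  refl: "w \<in> words S \<Longrightarrow> pres_eq S R w w"
| sym: "pres_eq S R u v \<Longrightarrow> pres_eq S R v u"
| trans: "pres_eq S R u v \<Longrightarrow> pres_eq S R v w \<Longrightarrow> pres_eq S R u w"
| cancel: "u \<in> words S \<Longrightarrow> v \<in> words S \<Longrightarrow> s \<in> S \<Longrightarrow>
    pres_eq S R (u @ [(s, b), (s, \<not> b)] @ v) (u @ v)"
| relation: "u \<in> words S \<Longrightarrow> v \<in> words S \<Longrightarrow> l \<in> words S \<Longrightarrow> r \<in> words S \<Longrightarrow> (l, r) \<in> R \<Longrightarrow>
    pres_eq S R (u @ l @ v) (u @ r @ v)"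

definition pres_rel :: "'a set \<Rightarrow> ('a word \<times> 'a word) set \<Rightarrow> ('a word \<times> 'a word) set"
  where "pres_rel S R = {(u, v). pres_eq S R u v}"

definition presented_group :: "'a set \<Rightarrow> ('a word \<times> 'a word) set \<Rightarrow> 'a word set monoid"
  where "presented_group S R =
    \<lparr>carrier = words S // pres_rel S R,
     mult = (\<lambda>A B. \<Union>x\<in>A. \<Union>y\<in>B. pres_rel S R `` {x @ y}),
     one = pres_rel S R `` {[]}\<rparr>"

definition pres_gen :: "'a set \<Rightarrow> ('a word \<times> 'a word) set \<Rightarrow> 'a \<Rightarrow> 'a word set"
  where "pres_gen S R s = pres_rel S R `` {[(s, True)]}"

fun eval_word :: "('g, 'b) monoid_scheme \<Rightarrow> ('a \<Rightarrow> 'g) \<Rightarrow> 'a word \<Rightarrow> 'g"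
  where
  "eval_word G \<phi> [] = \<one>\<^bsub>G\<^esub>"
| "eval_word G \<phi> ((s, b) # w) = (if b then \<phi> s else inv\<^bsub>G\<^esub> (\<phi> s)) \<otimes>\<^bsub>G\<^esub> eval_word G \<phi> w"

text \<open>The homomorphism from a presented group to \<open>G\<close> that extends \<open>\<phi>\<close> on the generators; it is
  meaningful when \<open>\<phi>\<close> respects the relations, see \<open>pres_lift_hom\<close> and \<open>pres_lift_gen\<close>.\<close>

definition pres_lift :: "('g, 'b) monoid_scheme \<Rightarrow> ('a \<Rightarrow> 'g) \<Rightarrow> 'a word set \<Rightarrow> 'g"
  where "pres_lift G \<phi> A = the_elem (eval_word G \<phi> ` A)"

lemma pres_eq_words: "pres_eq S R u v \<Longrightarrow> u \<in> words S \<and> v \<in> words S"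
  by (induction rule: pres_eq.induct) auto

lemma equiv_pres_rel: "equiv (words S) (pres_rel S R)"
proof (rule equivI)
  show "pres_rel S R \<subseteq> words S \<times> words S"
    using pres_eq_words[of S R] unfolding pres_rel_def by blast
  show "refl_on (words S) (pres_rel S R)"
    unfolding refl_on_def pres_rel_def by (simp add: pres_eq.refl)
  show "sym_on UNIV (pres_rel S R)"
    unfolding sym_on_def pres_rel_def by (simp add: pres_eq.sym)
  show "trans_on UNIV (pres_rel S R)"
    unfolding trans_on_def pres_rel_def using pres_eq.trans[of S R] by blast
qed

lemma pres_eq_append_left: "pres_eq S R u v \<Longrightarrow> w \<in> words S \<Longrightarrow> pres_eq S R (w @ u) (w @ v)"
proof (induction rule: pres_eq.induct)
  case (refl u)
  then show ?case by (simp add: pres_eq.refl)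
next
  case (sym u v)
  then show ?case by (simp add: pres_eq.sym)
next
  case (trans u v x)
  then show ?case using pres_eq.trans[of S R "w @ u" "w @ v" "w @ x"] by simp
next
  case (cancel u v s b)
  then show ?case using pres_eq.cancel[of "w @ u" S v s R b] by simp
next
  case (relation u v l r)
  then show ?case using pres_eq.relation[of "w @ u" S v l r R] by simp
qed

lemma pres_eq_append_right: "pres_eq S R u v \<Longrightarrow> w \<in> words S \<Longrightarrow> pres_eq S R (u @ w) (v @ w)"
proof (induction rule: pres_eq.induct)
  case (refl u)
  then show ?case by (simp add: pres_eq.refl)
next
  case (sym u v)
  then show ?case by (simp add: pres_eq.sym)
next
  case (trans u v x)
  then show ?case using pres_eq.trans[of S R "u @ w" "v @ w" "x @ w"] by simp
next
  case (cancel u v s b)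
  then show ?case using pres_eq.cancel[of u S "v @ w" s R b] by simp
next
  case (relation u v l r)
  then show ?case using pres_eq.relation[of u S "v @ w" l r R] by simp
qed

lemma pres_eq_append:
  "pres_eq S R u u' \<Longrightarrow> pres_eq S R v v' \<Longrightarrow> pres_eq S R (u @ v) (u' @ v')"
  by (rule pres_eq.trans[OF pres_eq_append_right pres_eq_append_left])
    (simp_all add: pres_eq_words)

lemma pres_class_eq_iff:
  "u \<in> words S \<Longrightarrow> v \<in> words S \<Longrightarrow> pres_rel S R `` {u} = pres_rel S R `` {v} \<longleftrightarrow> pres_eq S R u v"
  using eq_equiv_class_iff[OF equiv_pres_rel, of u S v R] by (simp add: pres_rel_def)

lemma presented_group_carrierE:
  assumes "A \<in> carrier (presented_group S R)"
  obtains u where "u \<in> words S" "A = pres_rel S R `` {u}"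
  using assms by (auto simp: presented_group_def elim!: quotientE)

lemma presented_group_class_closed:
  "u \<in> words S \<Longrightarrow> pres_rel S R `` {u} \<in> carrier (presented_group S R)"
  by (simp add: presented_group_def quotientI)

lemma presented_group_mult:
  assumes "u \<in> words S" "v \<in> words S"
  shows "pres_rel S R `` {u} \<otimes>\<^bsub>presented_group S R\<^esub> pres_rel S R `` {v} = pres_rel S R `` {u @ v}"
proof -
  have "pres_rel S R `` {x @ y} = pres_rel S R `` {u @ v}"
    if "x \<in> pres_rel S R `` {u}" "y \<in> pres_rel S R `` {v}" for x y
  proof -
    have e: "pres_eq S R u x" "pres_eq S R v y"
      using that by (auto simp: pres_rel_def)
    then have "pres_eq S R (u @ v) (x @ y)"
      by (rule pres_eq_append)
    then show ?thesis
      using e equiv_class_eq[OF equiv_pres_rel, of "u @ v" "x @ y" S R] by (auto simp: pres_rel_def)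
  qed
  moreover have "u \<in> pres_rel S R `` {u}" "v \<in> pres_rel S R `` {v}"
    using assms by (simp_all add: pres_rel_def pres_eq.refl)
  ultimately have "(\<Union>x\<in>pres_rel S R `` {u}. \<Union>y\<in>pres_rel S R `` {v}. pres_rel S R `` {x @ y}) =
      pres_rel S R `` {u @ v}"
    by blast
  then show ?thesis
    by (simp add: presented_group_def)
qed

lemma pres_eq_inverse:
  "w \<in> words S \<Longrightarrow> pres_eq S R (rev (map (\<lambda>(s, b). (s, \<not> b)) w) @ w) []"
proof (induction w)
  case Nil
  then show ?case by (auto intro: pres_eq.refl)
next
  case (Cons a w)
  obtain s b where a: "a = (s, b)" by (cases a)
  let ?i = "rev (map (\<lambda>(s, b). (s, \<not> b)) w)"
  have w: "w \<in> words S" "s \<in> S" and i: "?i \<in> words S"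
    using Cons.prems a by (auto simp: in_lists_conv_set)
  have "pres_eq S R (?i @ [(s, \<not> b), (s, \<not> \<not> b)] @ w) (?i @ w)"
    by (rule pres_eq.cancel) (use w i in auto)
  from pres_eq.trans[OF this Cons.IH[OF w(1)]] show ?case
    by (simp add: a)
qed

lemma group_presented_group: "group (presented_group S R)" (is "group ?G")
proof (rule groupI)
  have one: "\<one>\<^bsub>?G\<^esub> = pres_rel S R `` {[]}"
    by (simp add: presented_group_def)
  show "\<one>\<^bsub>?G\<^esub> \<in> carrier ?G"
    unfolding one by (rule presented_group_class_closed) simp
  fix A assume A: "A \<in> carrier ?G"
  then obtain u where u: "u \<in> words S" "A = pres_rel S R `` {u}"
    by (rule presented_group_carrierE)
  show "\<one>\<^bsub>?G\<^esub> \<otimes>\<^bsub>?G\<^esub> A = A"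
    unfolding one u(2) using u(1) by (subst presented_group_mult) auto
  let ?i = "rev (map (\<lambda>(s, b). (s, \<not> b)) u)"
  have i: "?i \<in> words S"
    using u(1) by (auto simp: in_lists_conv_set)
  have "pres_rel S R `` {?i} \<otimes>\<^bsub>?G\<^esub> A = \<one>\<^bsub>?G\<^esub>"
    unfolding one u(2) presented_group_mult[OF i u(1)]
    using pres_eq_inverse[OF u(1)] i u(1) by (subst pres_class_eq_iff) auto
  then show "\<exists>B\<in>carrier ?G. B \<otimes>\<^bsub>?G\<^esub> A = \<one>\<^bsub>?G\<^esub>"
    using presented_group_class_closed[OF i] by blast
  fix B assume "B \<in> carrier ?G"
  then obtain v where v: "v \<in> words S" "B = pres_rel S R `` {v}"
    by (rule presented_group_carrierE)
  show "A \<otimes>\<^bsub>?G\<^esub> B \<in> carrier ?G"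
    unfolding u(2) v(2) presented_group_mult[OF u(1) v(1)]
    using u(1) v(1) by (intro presented_group_class_closed) auto
  fix C assume "C \<in> carrier ?G"
  then obtain w where w: "w \<in> words S" "C = pres_rel S R `` {w}"
    by (rule presented_group_carrierE)
  show "A \<otimes>\<^bsub>?G\<^esub> B \<otimes>\<^bsub>?G\<^esub> C = A \<otimes>\<^bsub>?G\<^esub> (B \<otimes>\<^bsub>?G\<^esub> C)"
    unfolding u(2) v(2) w(2) using u(1) v(1) w(1) by (simp add: presented_group_mult)
qed

lemma eval_word_closed:
  assumes "group G" "\<phi> \<in> S \<rightarrow> carrier G"
  shows "w \<in> words S \<Longrightarrow> eval_word G \<phi> w \<in> carrier G"
proof (induction w)
  case Nil
  interpret group G by fact
  show ?case by simp
next
  case (Cons a w)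
  interpret group G by fact
  show ?case using Cons assms(2) by (cases a) (auto simp: Pi_iff)
qed

lemma eval_word_append:
  assumes "group G" "\<phi> \<in> S \<rightarrow> carrier G" "v \<in> words S"
  shows "u \<in> words S \<Longrightarrow> eval_word G \<phi> (u @ v) = eval_word G \<phi> u \<otimes>\<^bsub>G\<^esub> eval_word G \<phi> v"
proof (induction u)
  case Nil
  interpret group G by fact
  show ?case using eval_word_closed[OF assms] by simp
next
  case (Cons a u)
  interpret group G by fact
  have "a \<in> S \<times> UNIV" "u \<in> words S" using Cons.prems by auto
  then show ?case
    using Cons.IH assms(2) eval_word_closed[OF assms] eval_word_closed[OF assms(1,2), of u]
    by (cases a) (auto simp: m_assoc Pi_iff)
qed

lemma eval_word_cong:
  assumes "group G" "\<phi> \<in> S \<rightarrow> carrier G"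
    and R: "\<forall>(l, r)\<in>R. eval_word G \<phi> l = eval_word G \<phi> r"
  shows "pres_eq S R u v \<Longrightarrow> eval_word G \<phi> u = eval_word G \<phi> v"
proof (induction rule: pres_eq.induct)
  case (cancel u v s b)
  interpret group G by fact
  have s: "\<phi> s \<in> carrier G" using assms(2) cancel by auto
  have "eval_word G \<phi> ([(s, b), (s, \<not> b)] @ v) = eval_word G \<phi> v"
    using s eval_word_closed[OF assms(1,2) cancel(2)]
    by (auto simp: m_assoc[symmetric])
  then show ?case
    using cancel by (simp add: eval_word_append[OF assms(1,2)] del: eval_word.simps)
next
  case (relation u v l r)
  with R have "eval_word G \<phi> l = eval_word G \<phi> r" by blast
  with relation show ?case by (simp add: eval_word_append[OF assms(1,2)])
qed auto

lemma pres_lift_class: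
  assumes "group G" "\<phi> \<in> S \<rightarrow> carrier G"
    and R: "\<forall>(l, r)\<in>R. eval_word G \<phi> l = eval_word G \<phi> r"
    and u: "u \<in> words S"
  shows "pres_lift G \<phi> (pres_rel S R `` {u}) = eval_word G \<phi> u"
proof -
  have "eval_word G \<phi> ` (pres_rel S R `` {u}) = {eval_word G \<phi> u}"
  proof -
    have "eval_word G \<phi> v = eval_word G \<phi> u" if "v \<in> pres_rel S R `` {u}" for v
      using eval_word_cong[OF assms(1-3), where u = u and v = v] that by (simp add: pres_rel_def)
    moreover have "u \<in> pres_rel S R `` {u}"
      using pres_eq.refl[OF u] by (simp add: pres_rel_def)
    ultimately show ?thesis by blast
  qed
  then show ?thesis by (simp add: pres_lift_def)
qed

lemma pres_lift_hom:
  assumes "group G" "\<phi> \<in> S \<rightarrow> carrier G"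
    and R: "\<forall>(l, r)\<in>R. eval_word G \<phi> l = eval_word G \<phi> r"
  shows "pres_lift G \<phi> \<in> hom (presented_group S R) G"
proof (rule homI)
  fix A assume "A \<in> carrier (presented_group S R)"
  then obtain u where u: "u \<in> words S" "A = pres_rel S R `` {u}"
    by (rule presented_group_carrierE)
  show "pres_lift G \<phi> A \<in> carrier G"
    unfolding u(2) pres_lift_class[OF assms u(1)] by (rule eval_word_closed[OF assms(1,2) u(1)])
  fix B assume "B \<in> carrier (presented_group S R)"
  then obtain v where v: "v \<in> words S" "B = pres_rel S R `` {v}"
    by (rule presented_group_carrierE)
  have uv: "u @ v \<in> words S" using u(1) v(1) by simp
  show "pres_lift G \<phi> (A \<otimes>\<^bsub>presented_group S R\<^esub> B) = pres_lift G \<phi> A \<otimes>\<^bsub>G\<^esub> pres_lift G \<phi> B"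
    unfolding u(2) v(2) presented_group_mult[OF u(1) v(1)]
    pres_lift_class[OF assms u(1)] pres_lift_class[OF assms v(1)]
    pres_lift_class[OF assms uv]
    using u(1) v(1) by (simp add: eval_word_append[OF assms(1,2)])
qed

lemma pres_lift_gen:
  assumes "group G" "\<phi> \<in> S \<rightarrow> carrier G"
    and "\<forall>(l, r)\<in>R. eval_word G \<phi> l = eval_word G \<phi> r" and "s \<in> S"
  shows "pres_lift G \<phi> (pres_gen S R s) = \<phi> s"
proof -
  interpret group G by fact
  have "\<phi> s \<in> carrier G" using assms(2,4) by auto
  then show ?thesis
    unfolding pres_gen_def using assms(4) by (subst pres_lift_class[OF assms(1-3)]) auto
qed


section \<open>Coxeter groups and generalized braid groups\<close>

definition coxeter_matrix :: "'a set \<Rightarrow> ('a \<Rightarrow> 'a \<Rightarrow> enat) \<Rightarrow> bool"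
  where "coxeter_matrix S M \<longleftrightarrow> finite S \<and>
    (\<forall>s\<in>S. M s s = 1) \<and>
    (\<forall>s\<in>S. \<forall>t\<in>S. M s t = M t s) \<and>
    (\<forall>s\<in>S. \<forall>t\<in>S. s \<noteq> t \<longrightarrow> 2 \<le> M s t)"

fun alternating :: "nat \<Rightarrow> 'a \<Rightarrow> 'a \<Rightarrow> 'a word"
  where
  "alternating 0 s t = []"
| "alternating (Suc k) s t = (s, True) # alternating k t s"

definition coxeter_relations :: "'a set \<Rightarrow> ('a \<Rightarrow> 'a \<Rightarrow> enat) \<Rightarrow> ('a word \<times> 'a word) set"
  where "coxeter_relations S M =
    {(concat (replicate k [(s, True), (t, True)]), []) | s t k. s \<in> S \<and> t \<in> S \<and> M s t = enat k}"

definition braid_relations :: "'a set \<Rightarrow> ('a \<Rightarrow> 'a \<Rightarrow> enat) \<Rightarrow> ('a word \<times> 'a word) set"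
  where "braid_relations S M =
    {(alternating k s t, alternating k t s) | s t k. s \<in> S \<and> t \<in> S \<and> s \<noteq> t \<and> M s t = enat k}"

definition coxeter_group :: "'a set \<Rightarrow> ('a \<Rightarrow> 'a \<Rightarrow> enat) \<Rightarrow> 'a word set monoid"
  where "coxeter_group S M = presented_group S (coxeter_relations S M)"

definition braid_group :: "'a set \<Rightarrow> ('a \<Rightarrow> 'a \<Rightarrow> enat) \<Rightarrow> 'a word set monoid"
  where "braid_group S M = presented_group S (braid_relations S M)"

definition braid_proj :: "'a set \<Rightarrow> ('a \<Rightarrow> 'a \<Rightarrow> enat) \<Rightarrow> 'a word set \<Rightarrow> 'a word set"
  where "braid_proj S M = pres_lift (coxeter_group S M) (pres_gen S (coxeter_relations S M))"

definition pure_braid_group :: "'a set \<Rightarrow> ('a \<Rightarrow> 'a \<Rightarrow> enat) \<Rightarrow> 'a word set monoid"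
  where "pure_braid_group S M =
    (braid_group S M)\<lparr>carrier := kernel (braid_group S M) (coxeter_group S M) (braid_proj S M)\<rparr>"

definition coxeter_type_A :: "nat \<Rightarrow> 'a set \<Rightarrow> ('a \<Rightarrow> 'a \<Rightarrow> enat) \<Rightarrow> bool"
  where "coxeter_type_A n S M \<longleftrightarrow> coxeter_matrix S M \<and>
    (\<exists>s. bij_betw s {1..n} S \<and>
      (\<forall>i. 1 \<le> i \<and> i + 1 \<le> n \<longrightarrow> M (s i) (s (i + 1)) = 3) \<and>
      (\<forall>i j. 1 \<le> i \<and> i + 2 \<le> j \<and> j \<le> n \<longrightarrow> M (s i) (s j) = 2))"

definition coxeter_type_B :: "nat \<Rightarrow> 'a set \<Rightarrow> ('a \<Rightarrow> 'a \<Rightarrow> enat) \<Rightarrow> bool"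
  where "coxeter_type_B n S M \<longleftrightarrow> coxeter_matrix S M \<and>
    (\<exists>s. bij_betw s {1..n} S \<and>
      M (s 1) (s 2) = 4 \<and>
      (\<forall>i. 2 \<le> i \<and> i + 1 \<le> n \<longrightarrow> M (s i) (s (i + 1)) = 3) \<and>
      (\<forall>i j. 1 \<le> i \<and> i + 2 \<le> j \<and> j \<le> n \<longrightarrow> M (s i) (s j) = 2))"

definition coxeter_type_I2 :: "nat \<Rightarrow> 'a set \<Rightarrow> ('a \<Rightarrow> 'a \<Rightarrow> enat) \<Rightarrow> bool"
  where "coxeter_type_I2 k S M \<longleftrightarrow> coxeter_matrix S M \<and>
    (\<exists>s1 s2. s1 \<noteq> s2 \<and> S = {s1, s2} \<and> M s1 s2 = enat k)"


section \<open>The classical braid groups\<close>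

text \<open>The generator \<open>\<sigma>\<^sub>i\<close> is represented by the number \<open>i\<close>, where \<open>1 \<le> i \<le> m - 1\<close>.\<close>

definition artin_relations :: "nat \<Rightarrow> (nat word \<times> nat word) set"
  where "artin_relations m =
    {([(i, True), (j, True)], [(j, True), (i, True)]) | i j.
       i \<in> {1..<m} \<and> j \<in> {1..<m} \<and> (i + 2 \<le> j \<or> j + 2 \<le> i)} \<union>
    {([(i, True), (i + 1, True), (i, True)], [(i + 1, True), (i, True), (i + 1, True)]) | i.
       1 \<le> i \<and> i + 2 \<le> m}"

definition artin_group :: "nat \<Rightarrow> nat word set monoid"
  where "artin_group m = presented_group {1..<m} (artin_relations m)"

definition artin_proj :: "nat \<Rightarrow> nat word set \<Rightarrow> (nat \<Rightarrow> nat)"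
  where "artin_proj m = pres_lift (sym_group m) (\<lambda>i. transpose i (i + 1))"

definition pure_artin_group :: "nat \<Rightarrow> nat word set monoid"
  where "pure_artin_group m =
    (artin_group m)\<lparr>carrier := kernel (artin_group m) (sym_group m) (artin_proj m)\<rparr>"


section \<open>Short exact sequences\<close>

text \<open>The library predicate \<^const>\<open>exact_seq\<close> requires all groups of the sequence to have the same
  element type, hence this heterogeneous version of exactness of \<open>1 \<rightarrow> K \<rightarrow> G \<rightarrow> H \<rightarrow> 1\<close>.\<close>

definition short_exact ::
    "'k monoid \<Rightarrow> ('k \<Rightarrow> 'g) \<Rightarrow> 'g monoid \<Rightarrow> ('g \<Rightarrow> 'h) \<Rightarrow> 'h monoid \<Rightarrow> bool"
  where "short_exact K \<iota> G p H \<longleftrightarrow> group K \<and> group G \<and> group H \<and>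
    \<iota> \<in> mon K G \<and> p \<in> epi G H \<and> \<iota> ` carrier K = kernel G H p"

end

theory Submission
  imports Defs
begin

text \<open>
  For each type there is an explicit choice of positive braids \<open>F i\<close>, one for every Coxeter generator
  \<open>s\<^sub>i\<close>, that satisfies the braid relations of the type and whose permutations are
  involutions. The braid relations give \<open>f\<close>. An alternating braid relation between two involutions
  is the same as the Coxeter relation between them (\<open>alternating_eq_iff_power_one\<close>), so the
  underlying permutations give \<open>e\<close>, and the square commutes because it does so on generators.
  What remains is the choice of the braids and the injectivity of \<open>e\<close>.

  \<^item> Type \<open>A\<^sub>n\<close>: \<open>F i = \<sigma>\<^sub>i\<close> on \<open>n + 1\<close> strands.
  \<^item> Type \<open>B\<^sub>n\<close>: signed permutations as symmetric permutations of \<open>2n\<close> points. \<open>F 1\<close> is the middle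
    generator and \<open>F i\<close> is the product of two generators placed symmetrically about the middle;
    this is the folding of the diagram \<open>A\<close> with \<open>2n - 1\<close> nodes.
  \<^item> Type \<open>I\<^sub>2(k)\<close>: the product of the odd generators and the product of the even generators of the
    braid group on \<open>k\<close> strands. Both alternating products with \<open>k\<close> factors are the half twist
    (\<open>alternating_rows\<close>). A further crossing of two extra strands is multiplied to both braids; it
    makes every word of odd length act nontrivially, and it is what makes the case \<open>k = 2\<close> injective.

  The relation in type \<open>I\<^sub>2(k)\<close> is proved by viewing the alternating product as a brick wall, with one
  generator in every cell \<open>(r, c)\<close> (row \<open>r\<close>, column \<open>c\<close>) of fixed parity of \<open>r + c\<close>. Far commutation
  pulls out a diagonal \<open>\<sigma>\<^sub>1 \<sigma>\<^sub>2 \<dots> \<sigma>\<^sub>k\<^sub>-\<^sub>1\<close> (\<open>rows_split\<close>); moving what lies above it across the diagonal shifts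
  columns by one (\<open>slide_word\<close>), and the two remaining triangles then fit together to a brick wall with
  one column less and the other parity (\<open>rows_merge\<close>). So the two walls for \<open>k\<close> agree if those for
  \<open>k - 1\<close> do.

  Injectivity of \<open>e\<close> is a Schreier argument (\<open>transversal\<close>, \<open>stabilizer_word\<close>): if the words \<open>c x\<close>, \<open>x\<close> in
  an orbit of a point \<open>x\<^sub>0\<close>, satisfy \<open>s\<^sub>i c x = c (s\<^sub>i x) u\<close> modulo the Coxeter relations, with \<open>u\<close> a word in
  a smaller set of generators, then each word is \<open>c y\<close> times a word in the smaller set, where \<open>y\<close> is the
  image of \<open>x\<^sub>0\<close>. A word that acts trivially has \<open>y = x\<^sub>0\<close> and so reduces to the smaller set; iteration
  reduces it to the empty word.
\<close>

section \<open>Congruences on positive words\<close>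

text \<open>Both braids and Coxeter group elements are handled as lists of generators modulo such a
  congruence. Inverse letters are absent, so relations can be rewritten without membership conditions;
  \<open>word_eq_eval\<close> transports the result to the presented groups.\<close>

inductive word_eq :: "('i list \<times> 'i list) set \<Rightarrow> 'i list \<Rightarrow> 'i list \<Rightarrow> bool" for R where
  refl: "word_eq R w w"
| sym: "word_eq R u v \<Longrightarrow> word_eq R v u"
| trans [trans]: "word_eq R u v \<Longrightarrow> word_eq R v w \<Longrightarrow> word_eq R u w"
| step: "(l, r) \<in> R \<Longrightarrow> word_eq R (u @ l @ v) (u @ r @ v)"

lemma word_eq_relation: "(l, r) \<in> R \<Longrightarrow> word_eq R l r"
  using word_eq.step[of l r R "[]" "[]"] by simp

lemma word_eq_of_eq: "u = v \<Longrightarrow> word_eq R u v"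
  by (simp add: word_eq.refl)

lemma word_eq_context: "word_eq R u v \<Longrightarrow> word_eq R (a @ u @ b) (a @ v @ b)"
proof (induction rule: word_eq.induct)
  case (step l r u v)
  then show ?case using word_eq.step[of l r R "a @ u" "v @ b"] by simp
qed (blast intro: word_eq.intros)+

lemma word_eq_append: "word_eq R u u' \<Longrightarrow> word_eq R v v' \<Longrightarrow> word_eq R (u @ v) (u' @ v')"
  using word_eq_context[of R u u' "[]" v] word_eq_context[of R v v' u' "[]"]
  by (auto intro: word_eq.trans)

lemma word_eq_Cons: "word_eq R u v \<Longrightarrow> word_eq R (a # u) (a # v)"
  using word_eq_context[of R u v "[a]" "[]"] by simp

lemma word_eq_foldr:
  assumes "\<And>l r. (l, r) \<in> R \<Longrightarrow> foldr act l = foldr act r"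
  shows "word_eq R u v \<Longrightarrow> foldr act u = foldr act v"
  by (induction rule: word_eq.induct) (auto simp: fun_eq_iff dest!: assms)

lemma word_eq_commute1:
  assumes "\<And>j. j \<in> set u \<Longrightarrow> word_eq R [i, j] [j, i]"
  shows "word_eq R (i # u) (u @ [i])"
  using assms
proof (induction u)
  case (Cons j u)
  have "word_eq R (i # j # u) (j # i # u)"
    using word_eq_context[OF Cons.prems[of j], of "[]" u] by simp
  also have "word_eq R \<dots> (j # u @ [i])"
    using Cons by (intro word_eq_Cons) auto
  finally show ?case by simp
qed (simp add: word_eq.refl)

lemma word_eq_commute:
  assumes "\<And>i j. i \<in> set u \<Longrightarrow> j \<in> set v \<Longrightarrow> word_eq R [i, j] [j, i]"
  shows "word_eq R (u @ v) (v @ u)"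
  using assms
proof (induction u)
  case (Cons i u)
  have "word_eq R (i # u @ v) (i # v @ u)"
    using Cons by (intro word_eq_Cons) auto
  also have "word_eq R \<dots> ((v @ [i]) @ u)"
    using word_eq_append[OF word_eq_commute1[of v R i] word_eq.refl[of R u]] Cons.prems by auto
  finally show ?case by simp
qed (simp add: word_eq.refl)

text \<open>The relations of the braid monoid on infinitely many strands. Both sides of a relation have the
  same letters, so a derivation between words in the first \<open>m - 1\<close> letters stays among them and no bound
  on the letters is carried along.\<close>

definition braid_rels :: "(nat list \<times> nat list) set" where
  "braid_rels = {([i, j], [j, i]) | i j. i + 2 \<le> j \<or> j + 2 \<le> i} \<union>
    {([i, i + 1, i], [i + 1, i, i + 1]) | i. True}"

abbreviation braid_eq :: "nat list \<Rightarrow> nat list \<Rightarrow> bool" (infix "\<approx>" 50) where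
  "u \<approx> v \<equiv> word_eq braid_rels u v"

lemma braid_far: "i + 2 \<le> j \<or> j + 2 \<le> i \<Longrightarrow> [i, j] \<approx> [j, i]"
  by (rule word_eq_relation) (auto simp: braid_rels_def)

lemma braid_near: "[i, Suc i, i] \<approx> [Suc i, i, Suc i]"
  by (rule word_eq_relation) (auto simp: braid_rels_def)

lemma braid_commute:
  "(\<And>i j. i \<in> set u \<Longrightarrow> j \<in> set v \<Longrightarrow> i + 2 \<le> j \<or> j + 2 \<le> i) \<Longrightarrow> u @ v \<approx> v @ u"
  by (rule word_eq_commute) (blast intro: braid_far)

lemma braid_commute_pair:
  assumes "\<And>x y. x \<in> set u \<Longrightarrow> y \<in> set v \<Longrightarrow> x + 2 \<le> y \<or> y + 2 \<le> x"
  shows "a @ u @ v @ b \<approx> a @ v @ u @ b"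
proof -
  have "u @ v \<approx> v @ u" using assms by (rule braid_commute)
  from word_eq_context[OF this, of a b] show ?thesis by simp
qed

text \<open>The letter \<open>i\<close> commutes with the letters before \<open>i - 1\<close>, then one braid move turns
  \<open>i (i - 1) i\<close> into \<open>(i - 1) i (i - 1)\<close>, and \<open>i - 1\<close> commutes with all later letters. The braid move is
  asked for at \<open>i\<close> only: in type \<open>B\<close> the first two generators do not admit it.\<close>

lemma slide_ascending:
  assumes far: "\<And>i j. lo \<le> i \<Longrightarrow> i + 2 \<le> j \<Longrightarrow> j \<le> hi \<Longrightarrow> word_eq R [j, i] [i, j] \<and> word_eq R [i, j] [j, i]"
    and near: "word_eq R [i, i - 1, i] [i - 1, i, i - 1]"
    and i: "lo < i" "i \<le> hi"
  shows "word_eq R (i # [lo..<Suc hi]) ([lo..<Suc hi] @ [i - 1])"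
proof -
  have split: "[lo..<Suc hi] = [lo..<i - 1] @ [i - 1, i] @ [Suc i..<Suc hi]"
  proof -
    have "[lo..<Suc hi] = [lo..<i - 1] @ [i - 1..<Suc hi]"
      using upt_add_eq_append[of lo "i - 1" "Suc hi - (i - 1)"] i by simp
    also have "[i - 1..<Suc hi] = [i - 1, i] @ [Suc i..<Suc hi]"
      using i by (simp add: upt_conv_Cons del: upt_Suc)
    finally show ?thesis .
  qed
  have "word_eq R ((i # [lo..<i - 1]) @ ([i - 1, i] @ [Suc i..<Suc hi]))
      (([lo..<i - 1] @ [i]) @ ([i - 1, i] @ [Suc i..<Suc hi]))"
    by (rule word_eq_append[OF word_eq_commute1 word_eq.refl]) (use far i in auto)
  also have "word_eq R \<dots> ([lo..<i - 1] @ [i - 1, i] @ (i - 1) # [Suc i..<Suc hi])"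
    using word_eq_context[OF near, of "[lo..<i - 1]" "[Suc i..<Suc hi]"] by simp
  also have "word_eq R \<dots> ([lo..<i - 1] @ [i - 1, i] @ [Suc i..<Suc hi] @ [i - 1])"
    using i far by (intro word_eq_append word_eq.refl word_eq_commute1) auto
  finally show ?thesis unfolding split by simp
qed

lemma slide_descending:
  assumes far: "\<And>i j. lo \<le> i \<Longrightarrow> i + 2 \<le> j \<Longrightarrow> j \<le> hi \<Longrightarrow> word_eq R [j, i] [i, j] \<and> word_eq R [i, j] [j, i]"
    and near: "word_eq R [i, Suc i, i] [Suc i, i, Suc i]"
    and i: "lo \<le> i" "i < hi"
  shows "word_eq R (i # rev [lo..<Suc hi]) (rev [lo..<Suc hi] @ [Suc i])"
proof -
  let ?A = "rev [Suc (Suc i)..<Suc hi]" and ?C = "rev [lo..<i]"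
  have split: "rev [lo..<Suc hi] = ?A @ [Suc i, i] @ ?C"
  proof -
    have "[lo..<Suc hi] = [lo..<i] @ [i..<Suc hi]"
      using upt_add_eq_append[of lo i "Suc hi - i"] i by simp
    also have "[i..<Suc hi] = [i, Suc i] @ [Suc (Suc i)..<Suc hi]"
      using i by (simp add: upt_conv_Cons del: upt_Suc)
    finally show ?thesis by simp
  qed
  have "word_eq R ((i # ?A) @ ([Suc i, i] @ ?C)) ((?A @ [i]) @ ([Suc i, i] @ ?C))"
    by (rule word_eq_append[OF word_eq_commute1 word_eq.refl]) (use far i in auto)
  also have "word_eq R \<dots> (?A @ [Suc i, i] @ (Suc i) # ?C)"
    using word_eq_context[OF near, of ?A ?C] by simp
  also have "word_eq R \<dots> (?A @ [Suc i, i] @ ?C @ [Suc i])"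
    using i far by (intro word_eq_append word_eq.refl word_eq_commute1) auto
  finally show ?thesis unfolding split by simp
qed

section \<open>The two alternating products of the even and odd generators agree\<close>

definition columns :: "bool \<Rightarrow> nat \<Rightarrow> nat \<Rightarrow> nat list" where
  "columns p a b = filter (\<lambda>c. odd c = p) [a..<b]"

lemma set_columns: "c \<in> set (columns p a b) \<longleftrightarrow> a \<le> c \<and> c < b \<and> odd c = p"
  by (auto simp: columns_def)

lemma columns_append: "a \<le> b \<Longrightarrow> b \<le> c \<Longrightarrow> columns p a b @ columns p b c = columns p a c"
  using upt_add_eq_append[of a b "c - b"] by (simp add: columns_def flip: filter_append)

lemma columns_self: "columns (odd j) j (Suc j) = [j]" by (simp add: columns_def)

lemma columns_other_parity: "columns (even j) j (Suc j) = []" by (simp add: columns_def)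

lemma columns_empty: "b \<le> a \<Longrightarrow> columns p a b = []" by (simp add: columns_def)

lemma same_parity_gap: "x < y \<Longrightarrow> odd x = odd y \<Longrightarrow> x + 2 \<le> y" for x y :: nat
  by (cases "y = Suc x") auto

lemma sorted_columns: "sorted_wrt (\<lambda>i j. i + 2 \<le> j) (columns p a b)"
proof -
  have "sorted_wrt (<) (columns p a b)"
    unfolding columns_def by (intro sorted_wrt_filter sorted_wrt_upt)
  then show ?thesis
    by (rule sorted_wrt_mono_rel[rotated]) (simp only: set_columns same_parity_gap)
qed

lemma map_pred_columns:
  "map (\<lambda>c. c - 1) (columns p (Suc a) (Suc b)) = columns (\<not> p) a b"
proof -
  have *: "(\<lambda>c. odd (Suc c) = p) = (\<lambda>c. odd c = (\<not> p))" by auto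
  have "columns p (Suc a) (Suc b) = map Suc (columns (\<not> p) a b)"
    by (simp only: columns_def map_Suc_upt[symmetric] filter_map comp_def *)
  then show ?thesis by (simp add: comp_def)
qed

lemma columns_split:
  assumes "1 \<le> j" "j < k"
  shows "columns (odd j) 1 k = columns (odd j) 1 j @ [j] @ columns (odd j) (Suc j) k"
  using columns_append[of j "Suc j" k "odd j"] columns_append[of 1 j k "odd j"] assms
  by (simp add: columns_self)

text \<open>Row \<open>j\<close> has an entry in column \<open>j\<close>, and these diagonal entries can be collected in the middle:
  the part of row \<open>j\<close> right of column \<open>j\<close> commutes with everything of the earlier rows that lies on or
  below the diagonal, and the part left of column \<open>j\<close> commutes with the rest of its row.
  The rows \<open>1..k - 1\<close> are common to both walls with the columns \<open>1..k - 1\<close>; one of them has a further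
  row 0 above the diagonal, the other a further row \<open>k\<close> below it.\<close>

lemma rows_split:
  assumes "r < k"
  shows "concat (map (\<lambda>j. columns (odd j) 1 k) [1..<Suc r]) \<approx>
    concat (map (\<lambda>j. columns (odd j) (Suc j) k) [1..<Suc r]) @ [1..<Suc r] @
      concat (map (\<lambda>j. columns (odd j) 1 j) [1..<Suc r])"
  using assms
proof (induction r)
  case 0
  then show ?case by (simp add: word_eq.refl)
next
  case (Suc r)
  define U where "U = concat (map (\<lambda>j. columns (odd j) (Suc j) k) [1..<Suc r])"
  define L where "L = concat (map (\<lambda>j. columns (odd j) 1 j) [1..<Suc r])"
  define r' where "r' = Suc r"
  define u where "u = columns (odd r') (Suc r') k"
  define l where "l = columns (odd r') 1 r'"
  have L: "c + 2 \<le> r'" if "c \<in> set L" for c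
    using that by (force simp: L_def r'_def set_columns)
  have u: "r' + 2 \<le> c" if "c \<in> set u" for c
    using that same_parity_gap[of r' c] by (simp add: u_def set_columns)
  have l: "c + 2 \<le> r'" if "c \<in> set l" for c
    using that same_parity_gap[of c r'] by (simp add: l_def set_columns)
  have "concat (map (\<lambda>j. columns (odd j) 1 k) [1..<Suc r'])
      = concat (map (\<lambda>j. columns (odd j) 1 k) [1..<Suc r]) @ (l @ [r'] @ u)"
    using columns_split[of r' k] Suc.prems unfolding r'_def l_def u_def by simp
  also have "\<dots> \<approx> (U @ [1..<r'] @ L) @ (l @ ([r'] @ u))"
    using Suc by (intro word_eq_append word_eq.refl) (simp add: U_def L_def r'_def)
  also have "\<dots> \<approx> (U @ [1..<r'] @ L) @ (([r'] @ u) @ l)"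
    by (intro word_eq_append word_eq.refl braid_commute) (auto dest!: l u)
  also have "\<dots> = (U @ [1..<r']) @ (L @ [r'] @ u) @ l" by simp
  also have "\<dots> \<approx> (U @ [1..<r']) @ (([r'] @ u) @ L) @ l"
    by (intro word_eq_append word_eq.refl braid_commute) (auto dest!: L u)
  also have "\<dots> = U @ ([1..<Suc r'] @ u) @ L @ l" by (simp add: r'_def)
  also have "\<dots> \<approx> U @ (u @ [1..<Suc r']) @ L @ l"
    by (intro word_eq_append word_eq.refl braid_commute) (auto dest!: u)
  finally show ?case by (simp add: U_def L_def u_def l_def r'_def)
qed

lemma slide_word:
  assumes "set u \<subseteq> {2..n}"
  shows "u @ [1..<Suc n] \<approx> [1..<Suc n] @ map (\<lambda>c. c - 1) u"
  using assms
proof (induction u)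
  case Nil
  then show ?case by (simp add: word_eq.refl)
next
  case (Cons i u)
  have near: "[i, i - 1, i] \<approx> [i - 1, i, i - 1]"
    using word_eq.sym[OF braid_near[of "i - 1"]] Cons.prems by simp
  have "i # u @ [1..<Suc n] \<approx> i # [1..<Suc n] @ map (\<lambda>c. c - 1) u"
    using Cons by (intro word_eq_Cons) auto
  also have "\<dots> = (i # [1..<Suc n]) @ map (\<lambda>c. c - 1) u" by simp
  also have "\<dots> \<approx> ([1..<Suc n] @ [i - 1]) @ map (\<lambda>c. c - 1) u"
    using Cons.prems by (intro word_eq_append word_eq.refl slide_ascending near conjI braid_far) auto
  finally show ?case by simp
qed

text \<open>After the shift, the upper triangle has the parity of the next row of the lower triangle, and
  together they fill complete rows. Interleaving them needs only far commutation.\<close>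

lemma rows_merge:
  assumes "a \<le> b" "b \<le> Suc k"
  shows "concat (map (\<lambda>j. columns (even j) (Suc j) k) [a..<b]) @
      concat (map (\<lambda>j. columns (odd j) 1 j) [Suc a..<Suc b]) \<approx>
    concat (map (\<lambda>j. columns (odd j) 1 k) [Suc a..<Suc b])"
  using assms
proof (induction b rule: dec_induct)
  case base
  then show ?case by (simp add: word_eq.refl)
next
  case (step b)
  define U where "U = concat (map (\<lambda>j. columns (even j) (Suc j) k) [a..<b])"
  define L where "L = concat (map (\<lambda>j. columns (odd j) 1 j) [Suc a..<Suc b])"
  define u where "u = columns (even b) (Suc b) k"
  define l where "l = columns (even b) 1 (Suc b)"
  have L: "c < b" if "c \<in> set L" for c
    using that by (force simp: L_def set_columns)
  have u: "b < c" if "c \<in> set u" for c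
    using that by (simp add: u_def set_columns)
  have l: "c < b" if "c \<in> set l" for c
    using that by (cases "c = b") (auto simp: l_def set_columns)
  have "concat (map (\<lambda>j. columns (even j) (Suc j) k) [a..<Suc b]) @
      concat (map (\<lambda>j. columns (odd j) 1 j) [Suc a..<Suc (Suc b)]) = U @ (u @ (L @ l))"
    using step by (simp add: U_def L_def u_def l_def)
  also have "\<dots> \<approx> U @ ((L @ l) @ u)"
    by (rule word_eq_append[OF word_eq.refl braid_commute]) (auto dest!: u l L)
  also have "\<dots> = (U @ L) @ (l @ u)" by simp
  also have "l @ u = columns (even b) 1 k"
  proof (cases "b < k")
    case False
    then have "b = k" using step by simp
    then show ?thesis
      using columns_append[of 1 k "Suc k" "even k"]
      by (cases "k = 0") (simp_all add: u_def l_def columns_other_parity columns_empty)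
  qed (simp add: u_def l_def columns_append)
  also have "(U @ L) @ columns (even b) 1 k \<approx>
      concat (map (\<lambda>j. columns (odd j) 1 k) [Suc a..<Suc b]) @ columns (even b) 1 k"
    using step by (intro word_eq_append word_eq.refl) (simp add: U_def L_def)
  finally show ?case using step by simp
qed

text \<open>The two alternating products for \<open>I\<^sub>2(k)\<close>: by induction, both are equal to the diagonal followed
  by one of the two products for \<open>k - 1\<close>.\<close>

lemma alternating_rows:
  "concat (map (\<lambda>j. columns (odd j) 1 k) [1..<Suc k]) \<approx> concat (map (\<lambda>j. columns (odd j) 1 k) [0..<k])"
proof (induction k)
  case 0
  then show ?case by (simp add: word_eq.refl)
next
  case (Suc k)
  let ?R = "\<lambda>k j. columns (odd j) 1 k"
  let ?C = "\<lambda>k a b. concat (map (?R k) [a..<b])"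
  let ?U = "\<lambda>a b. concat (map (\<lambda>j. columns (odd j) (Suc j) (Suc k)) [a..<b])"
  let ?U' = "\<lambda>a b. concat (map (\<lambda>j. columns (even j) j k) [a..<b])"
  let ?U'' = "\<lambda>a b. concat (map (\<lambda>j. columns (even j) (Suc j) k) [a..<b])"
  let ?L = "\<lambda>a b. concat (map (\<lambda>j. columns (odd j) 1 j) [a..<b])"
  let ?P = "[1..<Suc k]"
  have U'': "?U' a b = ?U'' a b" if "b \<le> Suc k" for a b
  proof -
    have "columns (even j) j k = columns (even j) (Suc j) k" if "j \<le> k" for j
    proof (cases "j < k")
      case True
      then show ?thesis
        using columns_append[of j "Suc j" k "even j"] by (simp add: columns_other_parity)
    qed (use that in \<open>simp add: columns_def\<close>)
    then show ?thesis using that by (intro arg_cong[where f = concat] map_cong) auto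
  qed
  have shift: "?U a b @ ?P \<approx> ?P @ ?U'' a b" if "b \<le> Suc k" for a b
  proof -
    have "2 \<le> c \<and> c \<le> k" if "c \<in> set (columns (odd j) (Suc j) (Suc k))" for c j
      using that same_parity_gap[of j c] by (simp add: set_columns)
    then have "set (?U a b) \<subseteq> {2..k}" by fastforce
    then have "?U a b @ ?P \<approx> ?P @ map (\<lambda>c. c - 1) (?U a b)" by (rule slide_word)
    also have "map (\<lambda>c. c - 1) (?U a b) = ?U' a b"
      by (simp only: map_concat map_map comp_def map_pred_columns not_not)
    finally show ?thesis using U''[OF that] by simp
  qed
  have mid: "?C (Suc k) 1 (Suc k) \<approx> ?U 1 (Suc k) @ ?P @ ?L 1 (Suc k)"
    by (rule rows_split) simp
  have rows_Suc: "?C (Suc k) 1 (Suc (Suc k)) = ?C (Suc k) 1 (Suc k) @ columns (even k) 1 (Suc k)"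
    by simp
  have drop_first: "?L 1 (Suc k) @ columns (even k) 1 (Suc k) = ?L (Suc 1) (Suc (Suc k))"
    using upt_conv_Cons[of 1 "Suc k"] by (simp add: columns_empty del: upt_Suc) (simp add: columns_empty)
  have reindex: "?C k (Suc 1) (Suc (Suc k)) = ?C k 0 k"
  proof -
    have "[Suc 1..<Suc (Suc k)] = map (\<lambda>j. Suc (Suc j)) [0..<k]"
      by (simp add: map_Suc_upt comp_def flip: map_map[of Suc Suc, unfolded comp_def])
    then show ?thesis by (simp add: comp_def del: upt_Suc)
  qed
  have "?C (Suc k) 1 (Suc (Suc k)) \<approx>
      (?U 1 (Suc k) @ ?P @ ?L 1 (Suc k)) @ columns (even k) 1 (Suc k)"
    unfolding rows_Suc by (intro word_eq_append mid word_eq.refl)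
  also have "\<dots> \<approx> (?U 1 (Suc k) @ ?P) @ ?L (Suc 1) (Suc (Suc k))"
    by (rule word_eq_of_eq) (simp only: append_assoc drop_first)
  also have "\<dots> \<approx> (?P @ ?U'' 1 (Suc k)) @ ?L (Suc 1) (Suc (Suc k))"
    by (intro word_eq_append shift word_eq.refl) simp
  also have "\<dots> \<approx> ?P @ (?U'' 1 (Suc k) @ ?L (Suc 1) (Suc (Suc k)))"
    by (rule word_eq_of_eq) (rule append_assoc)
  also have "\<dots> \<approx> ?P @ ?C k (Suc 1) (Suc (Suc k))"
    by (intro word_eq_append rows_merge word_eq.refl) simp_all
  finally have X: "?C (Suc k) 1 (Suc (Suc k)) \<approx> ?P @ ?C k 0 k" unfolding reindex .
  have first: "?C (Suc k) 0 (Suc k) = ?U 0 1 @ ?C (Suc k) 1 (Suc k)"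
    "?U 0 (Suc k) = ?U 0 1 @ ?U 1 (Suc k)"
    using upt_conv_Cons[of 0 "Suc k"] by (simp_all del: upt_Suc) simp_all
  have "?C (Suc k) 0 (Suc k) \<approx> ?U 0 1 @ ?U 1 (Suc k) @ ?P @ ?L 1 (Suc k)"
    unfolding first(1) by (intro word_eq_append mid word_eq.refl)
  also have "\<dots> \<approx> (?U 0 (Suc k) @ ?P) @ ?L 1 (Suc k)"
    by (rule word_eq_of_eq) (simp only: append_assoc first(2))
  also have "\<dots> \<approx> (?P @ ?U'' 0 (Suc k)) @ ?L 1 (Suc k)"
    by (intro word_eq_append shift word_eq.refl) simp
  also have "\<dots> \<approx> ?P @ (?U'' 0 k @ ?L (Suc 0) (Suc k))"
    by (rule word_eq_of_eq) (simp add: columns_empty)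
  also have "\<dots> \<approx> ?P @ ?C k (Suc 0) (Suc k)"
    by (intro word_eq_append rows_merge word_eq.refl) simp_all
  finally have Y: "?C (Suc k) 0 (Suc k) \<approx> ?P @ ?C k 1 (Suc k)" by simp
  note X
  also have "?P @ ?C k 0 k \<approx> ?P @ ?C k 1 (Suc k)"
    by (intro word_eq_append word_eq.refl word_eq.sym[OF Suc.IH])
  also note word_eq.sym[OF Y]
  finally show ?case .
qed

section \<open>Homomorphisms out of presented groups\<close>

abbreviation positive :: "'a list \<Rightarrow> 'a word" where
  "positive u \<equiv> map (\<lambda>a. (a, True)) u"

lemma positive_words: "positive u \<in> words S \<longleftrightarrow> u \<in> lists S"
  by (auto simp: in_lists_conv_set)

lemma short_exact_kernel:
  assumes "group G" "group H" "p \<in> epi G H"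
  shows "short_exact (G\<lparr>carrier := kernel G H p\<rparr>) id G p H"
proof -
  interpret group_hom G H p
    using assms by (auto simp: group_hom_def group_hom_axioms_def epi_def)
  have "group (G\<lparr>carrier := kernel G H p\<rparr>)"
    by (rule subgroup.subgroup_is_group[OF subgroup_kernel assms(1)])
  then show ?thesis
    using assms subgroup.subset[OF subgroup_kernel]
    by (auto simp: short_exact_def mon_def hom_def)
qed

lemma eval_word_hom:
  assumes "group G" "group H" "h \<in> hom G H" "\<phi> \<in> S \<rightarrow> carrier G"
  shows "w \<in> words S \<Longrightarrow> h (eval_word G \<phi> w) = eval_word H (h \<circ> \<phi>) w"
proof (induction w)
  case Nil
  then show ?case using assms by (simp add: hom_one)
next
  case (Cons a w)
  obtain s b where a: "a = (s, b)" by (cases a)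
  interpret group_hom G H h
    using assms by (auto simp: group_hom_def group_hom_axioms_def)
  have "\<phi> s \<in> carrier G" "eval_word G \<phi> w \<in> carrier G"
    using Cons.prems assms(4) a eval_word_closed[OF assms(1,4), of w] by auto
  then show ?case using Cons a by simp
qed

lemma eval_word_letters_cong:
  "(\<And>s. s \<in> S \<Longrightarrow> \<phi> s = \<psi> s) \<Longrightarrow> w \<in> words S \<Longrightarrow> eval_word G \<phi> w = eval_word G \<psi> w"
  by (induction w) auto

lemma eval_word_map: "eval_word G \<phi> (positive (map f u)) = eval_word G (\<phi> \<circ> f) (positive u)"
  by (induction u) auto

lemma eval_word_concat:
  assumes "group G" "\<phi> \<in> S \<rightarrow> carrier G" "\<And>i. i \<in> I \<Longrightarrow> F i \<in> lists S"
  shows "u \<in> lists I \<Longrightarrow>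
    eval_word G (\<lambda>i. eval_word G \<phi> (positive (F i))) (positive u) =
    eval_word G \<phi> (positive (concat (map F u)))"
proof (induction u)
  case (Cons i u)
  have "concat (map F u) \<in> lists S" using Cons.prems assms(3) by (auto simp: in_lists_conv_set)
  then show ?case
    using Cons assms(3)[of i] eval_word_append[OF assms(1,2), of "positive (concat (map F u))" "positive (F i)"]
    by (simp add: positive_words)
qed simp

lemma pres_gen_closed: "pres_gen S R \<in> S \<rightarrow> carrier (presented_group S R)"
  unfolding pres_gen_def by (auto intro!: presented_group_class_closed)

lemma inv_pres_gen:
  assumes "s \<in> S"
  shows "inv\<^bsub>presented_group S R\<^esub> (pres_gen S R s) = pres_rel S R `` {[(s, False)]}"
proof (rule group.inv_equality[OF group_presented_group])
  have "pres_eq S R [(s, False), (s, True)] []"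
    using pres_eq.cancel[of "[]" S "[]" s R False] assms by simp
  then show "pres_rel S R `` {[(s, False)]} \<otimes>\<^bsub>presented_group S R\<^esub> pres_gen S R s = \<one>\<^bsub>presented_group S R\<^esub>"
    using assms unfolding pres_gen_def
    by (simp add: presented_group_mult pres_class_eq_iff) (simp add: presented_group_def pres_class_eq_iff)
qed (use assms pres_gen_closed[of S R] in \<open>auto intro!: presented_group_class_closed\<close>)

lemma eval_word_gen:
  "w \<in> words S \<Longrightarrow> eval_word (presented_group S R) (pres_gen S R) w = pres_rel S R `` {w}"
proof (induction w)
  case Nil
  then show ?case by (simp add: presented_group_def)
next
  case (Cons a w)
  obtain s b where a: "a = (s, b)" by (cases a)
  have "s \<in> S" "w \<in> words S" using Cons.prems a by auto
  moreover from this have "(if b then pres_gen S R s else inv\<^bsub>presented_group S R\<^esub> (pres_gen S R s)) =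
      pres_rel S R `` {[(s, b)]}"
    by (cases b) (simp_all add: inv_pres_gen, simp add: pres_gen_def)
  ultimately show ?case
    using Cons.IH a presented_group_mult[of "[(s, b)]" S w R] by simp
qed

lemma eval_word_gen_relation:
  assumes "(l, r) \<in> R" "l \<in> words S" "r \<in> words S"
  shows "eval_word (presented_group S R) (pres_gen S R) l = eval_word (presented_group S R) (pres_gen S R) r"
  using pres_eq.relation[of "[]" S "[]" l r R] assms by (simp add: eval_word_gen pres_class_eq_iff)

text \<open>The first condition on the relations makes every intermediate word of a derivation a word over
  \<open>A\<close>. Without it a derivation could pass through letters on which \<open>h\<close> is arbitrary.\<close>

lemma word_eq_eval:
  assumes G: "group G" "h \<in> A \<rightarrow> carrier G"
    and R: "\<And>l r. (l, r) \<in> R \<Longrightarrow> l \<in> lists A \<longleftrightarrow> r \<in> lists A"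
      "\<And>l r. (l, r) \<in> R \<Longrightarrow> l \<in> lists A \<Longrightarrow> eval_word G h (positive l) = eval_word G h (positive r)"
  shows "word_eq R u v \<Longrightarrow> (u \<in> lists A \<longleftrightarrow> v \<in> lists A) \<and>
    (u \<in> lists A \<longrightarrow> eval_word G h (positive u) = eval_word G h (positive v))"
proof (induction rule: word_eq.induct)
  case (step l r u v)
  have "eval_word G h (positive (u @ l @ v)) = eval_word G h (positive (u @ r @ v))"
    if "u \<in> lists A" "l \<in> lists A" "v \<in> lists A"
    using that R(1)[OF step] R(2)[OF step] eval_word_append[OF G] by (simp add: positive_words)
  then show ?case using R(1)[OF step] by auto
qed auto

section \<open>Alternating words and Coxeter relations\<close>

fun alt :: "nat \<Rightarrow> 'a \<Rightarrow> 'a \<Rightarrow> 'a list" where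
  "alt 0 s t = []"
| "alt (Suc k) s t = s # alt k t s"

lemma alternating_alt: "alternating k s t = positive (alt k s t)"
  by (induction k arbitrary: s t) auto

lemma set_alt: "set (alt k s t) \<subseteq> {s, t}"
  by (induction k arbitrary: s t) auto

lemma alt_in_lists: "s \<in> A \<Longrightarrow> t \<in> A \<Longrightarrow> alt k s t \<in> lists A"
  using set_alt[of k s t] by auto

lemma map_alt: "map f (alt k s t) = alt k (f s) (f t)"
  by (induction k arbitrary: s t) auto

lemma eval_concat_replicate:
  fixes G (structure)
  assumes "group G" "\<phi> s \<in> carrier G" "\<phi> t \<in> carrier G"
  shows "eval_word G \<phi> (concat (replicate k [(s, True), (t, True)])) = (\<phi> s \<otimes>\<^bsub>G\<^esub> \<phi> t) [^]\<^bsub>G\<^esub> k"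
proof -
  interpret group G by fact
  show ?thesis
  proof (induction k)
    case (Suc k)
    have "\<phi> s \<otimes> (\<phi> t \<otimes> (\<phi> s \<otimes> \<phi> t) [^] k) = (\<phi> s \<otimes> \<phi> t) \<otimes> (\<phi> s \<otimes> \<phi> t) [^] k"
      using assms by (simp add: m_assoc)
    also have "\<dots> = (\<phi> s \<otimes> \<phi> t) [^] Suc k"
      using assms nat_pow_Suc2[of "\<phi> s \<otimes> \<phi> t" k] by simp
    finally show ?case using Suc by simp
  qed simp
qed

lemma (in group) shift_power:
  assumes "x \<in> carrier G" "y \<in> carrier G"
  shows "x \<otimes> (y \<otimes> x) [^] (k::nat) = (x \<otimes> y) [^] k \<otimes> x"
proof (induction k)
  case (Suc k)
  have "x \<otimes> (y \<otimes> x) [^] Suc k = (x \<otimes> (y \<otimes> x) [^] k) \<otimes> (y \<otimes> x)"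
    using assms by (simp add: m_assoc)
  also have "\<dots> = (x \<otimes> y) [^] Suc k \<otimes> x"
    unfolding Suc using assms by (simp add: m_assoc)
  finally show ?case .
qed (use assms in simp)

lemma eval_alternating_closed:
  assumes "group G" "\<phi> s \<in> carrier G" "\<phi> t \<in> carrier G"
  shows "eval_word G \<phi> (alternating k s t) \<in> carrier G"
proof -
  have "alternating k s t \<in> words {s, t}"
    by (simp only: alternating_alt positive_words) (simp add: alt_in_lists)
  then show ?thesis
    using eval_word_closed[of G \<phi> "{s, t}" "alternating k s t"] assms by auto
qed

text \<open>For involutions \<open>x\<close>, \<open>y\<close> the quotient of the alternating products \<open>x y x \<dots>\<close> and \<open>y x y \<dots>\<close> with \<open>k\<close>
  factors is \<open>(x y)\<^sup>k\<close>, because the second product is inverted by reversing it.\<close>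

lemma eval_alternating_swap:
  fixes G (structure)
  assumes "group G" "\<phi> s \<in> carrier G" "\<phi> t \<in> carrier G"
    and "\<phi> s \<otimes>\<^bsub>G\<^esub> \<phi> s = \<one>\<^bsub>G\<^esub>" "\<phi> t \<otimes>\<^bsub>G\<^esub> \<phi> t = \<one>\<^bsub>G\<^esub>"
  shows "eval_word G \<phi> (alternating k s t) =
    (\<phi> s \<otimes>\<^bsub>G\<^esub> \<phi> t) [^]\<^bsub>G\<^esub> k \<otimes>\<^bsub>G\<^esub> eval_word G \<phi> (alternating k t s)"
proof -
  interpret group G by fact
  have E: "eval_word G \<phi> (alternating j x y) \<in> carrier G" if "x \<in> {s, t}" "y \<in> {s, t}" for j x y
    using that by (intro eval_alternating_closed) (use assms in auto)
  have *: "eval_word G \<phi> (alternating k x y) =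
      (\<phi> x \<otimes> \<phi> y) [^] k \<otimes> eval_word G \<phi> (alternating k y x)"
    if "x \<in> {s, t}" "y \<in> {s, t}" for x y
    using that
  proof (induction k arbitrary: x y)
    case (Suc k)
    let ?e = "eval_word G \<phi> (alternating k x y)"
    have c: "\<phi> x \<in> carrier G" "\<phi> y \<in> carrier G" "\<phi> y \<otimes> \<phi> y = \<one>" "?e \<in> carrier G"
      using assms Suc.prems E by auto
    have "eval_word G \<phi> (alternating (Suc k) x y) = \<phi> x \<otimes> ((\<phi> y \<otimes> \<phi> x) [^] k \<otimes> ?e)"
      using Suc.IH[of y x] Suc.prems by simp
    also have "\<dots> = (\<phi> x \<otimes> (\<phi> y \<otimes> \<phi> x) [^] k) \<otimes> ?e"
      using c by (simp add: m_assoc)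
    also have "\<dots> = (\<phi> x \<otimes> \<phi> y) [^] k \<otimes> \<phi> x \<otimes> (\<phi> y \<otimes> \<phi> y) \<otimes> ?e"
      unfolding shift_power[OF c(1,2)] c(3) using c by simp
    also have "\<dots> = (\<phi> x \<otimes> \<phi> y) [^] Suc k \<otimes> (\<phi> y \<otimes> ?e)"
      using c(1,2,4) by (simp add: m_assoc)
    finally show ?case by simp
  qed simp
  show ?thesis by (rule *) auto
qed

lemma alternating_eq_iff_power_one:
  fixes G (structure)
  assumes "group G" "\<phi> s \<in> carrier G" "\<phi> t \<in> carrier G"
    and "\<phi> s \<otimes>\<^bsub>G\<^esub> \<phi> s = \<one>\<^bsub>G\<^esub>" "\<phi> t \<otimes>\<^bsub>G\<^esub> \<phi> t = \<one>\<^bsub>G\<^esub>"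
  shows "eval_word G \<phi> (alternating k s t) = eval_word G \<phi> (alternating k t s) \<longleftrightarrow>
    (\<phi> s \<otimes>\<^bsub>G\<^esub> \<phi> t) [^]\<^bsub>G\<^esub> k = \<one>\<^bsub>G\<^esub>"
proof -
  interpret group G by fact
  have "eval_word G \<phi> (alternating k t s) \<in> carrier G"
    by (intro eval_alternating_closed assms)
  then show ?thesis
    unfolding eval_alternating_swap[where k = k and s = s and t = t, OF assms]
    using assms by simp
qed

lemma coxeter_relations_respected:
  fixes G (structure)
  assumes "group G" "\<phi> \<in> S \<rightarrow> carrier G" "\<And>s. s \<in> S \<Longrightarrow> M s s = 1"
    and inv: "\<And>s. s \<in> S \<Longrightarrow> \<phi> s \<otimes>\<^bsub>G\<^esub> \<phi> s = \<one>\<^bsub>G\<^esub>"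
    and R: "\<forall>(l, r)\<in>braid_relations S M. eval_word G \<phi> l = eval_word G \<phi> r"
  shows "\<forall>(l, r)\<in>coxeter_relations S M. eval_word G \<phi> l = eval_word G \<phi> r"
proof -
  interpret group G by fact
  have "(\<phi> s \<otimes> \<phi> t) [^] k = \<one>" if st: "s \<in> S" "t \<in> S" "M s t = enat k" for s t k
  proof (cases "s = t")
    case True
    then show ?thesis using inv[OF st(1)] by simp
  next
    case False
    then have "(alternating k s t, alternating k t s) \<in> braid_relations S M"
      using st unfolding braid_relations_def by blast
    then have "eval_word G \<phi> (alternating k s t) = eval_word G \<phi> (alternating k t s)"
      using R by blast
    then show ?thesis
      using alternating_eq_iff_power_one[of G \<phi> s t k] assms st by auto
  qed
  then show ?thesis
    using assms by (auto simp: coxeter_relations_def eval_concat_replicate Pi_iff)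
qed

lemma coxeter_gen_involution:
  assumes "coxeter_matrix S M" "s \<in> S"
  shows "pres_gen S (coxeter_relations S M) s \<otimes>\<^bsub>coxeter_group S M\<^esub> pres_gen S (coxeter_relations S M) s
    = \<one>\<^bsub>coxeter_group S M\<^esub>"
proof -
  have "(concat (replicate 1 [(s, True), (s, True)]), []) \<in> coxeter_relations S M"
    unfolding coxeter_relations_def using assms
    by (auto simp: coxeter_matrix_def one_enat_def intro!: exI[of _ s] exI[of _ "1::nat"])
  from eval_word_gen_relation[OF this, of S] assms(2)
  have "pres_gen S (coxeter_relations S M) s \<otimes>\<^bsub>coxeter_group S M\<^esub>
      (pres_gen S (coxeter_relations S M) s \<otimes>\<^bsub>coxeter_group S M\<^esub> \<one>\<^bsub>coxeter_group S M\<^esub>)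
      = \<one>\<^bsub>coxeter_group S M\<^esub>"
    by (simp add: coxeter_group_def)
  moreover have "pres_gen S (coxeter_relations S M) s \<in> carrier (coxeter_group S M)"
    using assms(2) pres_gen_closed[of S "coxeter_relations S M"] by (auto simp: coxeter_group_def)
  moreover have "monoid (coxeter_group S M)"
    by (simp add: coxeter_group_def group.is_monoid group_presented_group)
  ultimately show ?thesis by (simp add: monoid.r_one)
qed

lemma braid_relations_respected:
  assumes "coxeter_matrix S M"
  shows "\<forall>(l, r)\<in>braid_relations S M. eval_word (coxeter_group S M) (pres_gen S (coxeter_relations S M)) l =
    eval_word (coxeter_group S M) (pres_gen S (coxeter_relations S M)) r"
proof -
  let ?g = "pres_gen S (coxeter_relations S M)"
  have G: "group (coxeter_group S M)" by (simp add: coxeter_group_def group_presented_group)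
  have g: "?g s \<in> carrier (coxeter_group S M)" if "s \<in> S" for s
    using that pres_gen_closed[of S "coxeter_relations S M"] by (auto simp: coxeter_group_def)
  have "eval_word (coxeter_group S M) ?g (alternating k s t) = eval_word (coxeter_group S M) ?g (alternating k t s)"
    if st: "s \<in> S" "t \<in> S" "M s t = enat k" for s t k
  proof -
    have "(concat (replicate k [(s, True), (t, True)]), []) \<in> coxeter_relations S M"
      using st by (auto simp: coxeter_relations_def)
    from eval_word_gen_relation[OF this, of S] st
    have "eval_word (coxeter_group S M) ?g (concat (replicate k [(s, True), (t, True)])) = \<one>\<^bsub>coxeter_group S M\<^esub>"
      by (auto simp: coxeter_group_def in_lists_conv_set)
    then show ?thesis
      using alternating_eq_iff_power_one[of "coxeter_group S M" ?g s t k]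
        eval_concat_replicate[of "coxeter_group S M" ?g s t k]
        coxeter_gen_involution[OF assms] G g st by simp
  qed
  then show ?thesis by (auto simp: braid_relations_def)
qed

lemma braid_proj_epi:
  assumes "coxeter_matrix S M"
  shows "braid_proj S M \<in> epi (braid_group S M) (coxeter_group S M)"
proof -
  let ?g = "pres_gen S (coxeter_relations S M)"
  have G: "group (coxeter_group S M)" "?g \<in> S \<rightarrow> carrier (coxeter_group S M)"
    by (simp_all add: coxeter_group_def group_presented_group pres_gen_closed)
  have "A \<in> braid_proj S M ` carrier (braid_group S M)" if A: "A \<in> carrier (coxeter_group S M)" for A
  proof -
    obtain w where w: "w \<in> words S" "A = pres_rel S (coxeter_relations S M) `` {w}"
      using A presented_group_carrierE unfolding coxeter_group_def by metis
    then have "A = braid_proj S M (pres_rel S (braid_relations S M) `` {w})"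
      unfolding braid_proj_def pres_lift_class[OF G braid_relations_respected[OF assms] w(1)]
      by (simp add: coxeter_group_def eval_word_gen)
    then show ?thesis
      using presented_group_class_closed[OF w(1)] unfolding braid_group_def by blast
  qed
  then show ?thesis
    using pres_lift_hom[OF G braid_relations_respected[OF assms]]
    by (auto simp: epi_iff_subset braid_proj_def braid_group_def)
qed

section \<open>Permutations of positive braid words\<close>

abbreviation perm_of :: "nat list \<Rightarrow> nat \<Rightarrow> nat" where
  "perm_of u \<equiv> foldr (\<lambda>i. transpose i (i + 1)) u"

lemma perm_of_braid_eq: "u \<approx> v \<Longrightarrow> perm_of u = perm_of v"
proof (erule word_eq_foldr[rotated])
  fix l r assume "(l, r) \<in> braid_rels"
  then show "perm_of l = perm_of r"
    unfolding braid_rels_def by (auto simp: fun_eq_iff transpose_def)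
qed

lemma far_word_involution:
  "sorted_wrt (\<lambda>i j. i + 2 \<le> j) u \<Longrightarrow> perm_of u (perm_of u x) = x"
proof (induction u arbitrary: x)
  case (Cons i u)
  have "[i] @ u \<approx> u @ [i]" by (rule braid_commute) (use Cons.prems in auto)
  from fun_cong[OF perm_of_braid_eq[OF this], of "perm_of ([i] @ u) x"]
  have "perm_of (i # u) (perm_of (i # u) x) = perm_of u (perm_of u x)" by simp
  then show ?case using Cons by simp
qed simp

lemma perm_of_concat: "perm_of (concat (map F u)) = foldr (\<lambda>i. perm_of (F i)) u"
  by (induction u) auto

lemma eval_word_sym_group:
  "eval_word (sym_group m) (\<lambda>i. perm_of (F i)) (positive u) = perm_of (concat (map F u))"
  by (induction u) (auto simp: sym_group_def id_def)

lemma perm_of_permutes: "u \<in> lists {1..<m} \<Longrightarrow> perm_of u permutes {1..m}"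
proof (induction u)
  case (Cons i u)
  then have "transpose i (i + 1) \<circ> perm_of u permutes {1..m}"
    by (intro permutes_compose permutes_swap_id) auto
  then show ?case by (simp add: comp_def)
qed (simp add: id_def[symmetric] permutes_id)

lemma perm_of_upt: "x \<le> n \<Longrightarrow> perm_of [x..<n] n = x"
proof (induction "n - x" arbitrary: x)
  case (Suc d)
  then have "perm_of [Suc x..<n] n = Suc x" by auto
  then show ?case using Suc by (simp add: upt_conv_Cons)
qed simp

text \<open>Multiplying by the word that carries the last point to its image leaves a permutation that
  fixes the last point.\<close>

lemma ex_perm_of:
  "p permutes {1..m} \<Longrightarrow> \<exists>u\<in>lists {1..<m}. perm_of u = p"
proof (induction m arbitrary: p)
  case 0
  then show ?case by (auto simp: permutes_empty id_def[symmetric] intro!: bexI[of _ "[]"])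
next
  case (Suc m)
  let ?x = "p (Suc m)"
  let ?q = "perm_of [?x..<Suc m]"
  have x: "?x \<in> {1..Suc m}" using permutes_in_image[OF Suc.prems, of "Suc m"] by simp
  have q: "?q permutes {1..Suc m}" by (rule perm_of_permutes) (use x in auto)
  have qm: "?q (Suc m) = ?x" by (rule perm_of_upt) (use x in simp)
  have perm: "inv' ?q \<circ> p permutes {1..Suc m}"
    by (intro permutes_compose Suc.prems permutes_inv q)
  have fixed: "(inv' ?q \<circ> p) (Suc m) = Suc m"
    using permutes_inverses(2)[OF q, of "Suc m"] qm by simp
  have "inv' ?q \<circ> p permutes {1..m}"
  proof (rule permutes_superset[OF perm])
    fix x assume "x \<in> {1..Suc m} - {1..m}"
    then have "x = Suc m" by auto
    then show "(inv' ?q \<circ> p) x = x" using fixed by simp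
  qed
  from Suc.IH[OF this] obtain u where u: "u \<in> lists {1..<m}" "perm_of u = inv' ?q \<circ> p" by blast
  have "perm_of ([?x..<Suc m] @ u) = p"
    using u(2) permutes_inverses(1)[OF q] by (simp add: fun_eq_iff)
  moreover have "[?x..<Suc m] @ u \<in> lists {1..<Suc m}" using x u(1) by auto
  ultimately show ?case by blast
qed

lemma transpositions_closed: "(\<lambda>i. transpose i (i + 1)) \<in> {1..<m} \<rightarrow> carrier (sym_group m)"
  by (auto simp: sym_group_carrier intro!: permutes_swap_id)

lemma artin_relationE:
  assumes "(l, r) \<in> artin_relations m"
  obtains u v where "l = positive u" "r = positive v" "(u, v) \<in> braid_rels"
    "u \<in> lists {1..<m}" "v \<in> lists {1..<m}"
proof -
  consider (far) i j where "l = positive [i, j]" "r = positive [j, i]" "i \<in> {1..<m}" "j \<in> {1..<m}"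
      "i + 2 \<le> j \<or> j + 2 \<le> i"
    | (near) i where "l = positive [i, i + 1, i]" "r = positive [i + 1, i, i + 1]" "1 \<le> i" "i + 2 \<le> m"
    using assms unfolding artin_relations_def by auto
  then show ?thesis
  proof cases
    case far
    then show ?thesis by (intro that[of "[i, j]" "[j, i]"]) (auto simp: braid_rels_def)
  next
    case near
    then show ?thesis
      by (intro that[of "[i, i + 1, i]" "[i + 1, i, i + 1]"]) (auto simp: braid_rels_def)
  qed
qed

lemma braid_rels_artin:
  assumes "(u, v) \<in> braid_rels" "u \<in> lists {1..<m}"
  shows "(positive u, positive v) \<in> artin_relations m"
proof -
  consider (far) i j where "u = [i, j]" "v = [j, i]" "i + 2 \<le> j \<or> j + 2 \<le> i"
    | (near) i where "u = [i, i + 1, i]" "v = [i + 1, i, i + 1]"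
    using assms(1) unfolding braid_rels_def by auto
  then show ?thesis using assms(2) unfolding artin_relations_def by cases auto
qed

lemma braid_rels_letters: "(u, v) \<in> braid_rels \<Longrightarrow> u \<in> lists A \<longleftrightarrow> v \<in> lists A"
  unfolding braid_rels_def by auto

lemma eval_word_transpositions:
  "eval_word (sym_group m) (\<lambda>i. transpose i (i + 1)) (positive u) = perm_of u"
  using eval_word_sym_group[of m "\<lambda>i. [i]" u] by simp

lemma artin_relations_respected:
  "\<forall>(l, r)\<in>artin_relations m. eval_word (sym_group m) (\<lambda>i. transpose i (i + 1)) l =
    eval_word (sym_group m) (\<lambda>i. transpose i (i + 1)) r"
proof safe
  fix l r assume "(l, r) \<in> artin_relations m"
  then obtain u v where uv: "l = positive u" "r = positive v" "(u, v) \<in> braid_rels"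
    by (rule artin_relationE)
  show "eval_word (sym_group m) (\<lambda>i. transpose i (i + 1)) l = eval_word (sym_group m) (\<lambda>i. transpose i (i + 1)) r"
    unfolding uv eval_word_transpositions by (rule perm_of_braid_eq[OF word_eq_relation[OF uv(3)]])
qed

lemma artin_proj_eval:
  assumes "u \<in> lists {1..<m}"
  shows "artin_proj m (eval_word (artin_group m) (pres_gen {1..<m} (artin_relations m)) (positive u)) = perm_of u"
proof -
  have u: "positive u \<in> words {1..<m}" using assms by (simp add: positive_words)
  show ?thesis
    unfolding artin_group_def eval_word_gen[OF u] artin_proj_def
      pres_lift_class[OF sym_group_is_group transpositions_closed artin_relations_respected u]
    by (rule eval_word_transpositions)
qed

lemma artin_proj_epi: "artin_proj m \<in> epi (artin_group m) (sym_group m)"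
proof -
  have "p \<in> artin_proj m ` carrier (artin_group m)" if p: "p \<in> carrier (sym_group m)" for p
  proof -
    obtain u where u: "u \<in> lists {1..<m}" "perm_of u = p"
      using ex_perm_of p by (auto simp: sym_group_carrier)
    have "eval_word (artin_group m) (pres_gen {1..<m} (artin_relations m)) (positive u) \<in> carrier (artin_group m)"
      using u unfolding artin_group_def
      by (intro eval_word_closed[OF group_presented_group pres_gen_closed]) (simp add: positive_words)
    then show ?thesis by (rule image_eqI[rotated]) (simp only: artin_proj_eval[OF u(1)] u(2))
  qed
  then show ?thesis
    using pres_lift_hom[OF sym_group_is_group transpositions_closed artin_relations_respected, of m]
    by (auto simp: epi_iff_subset artin_proj_def artin_group_def)
qed

lemma braid_eq_artin:
  assumes "u \<approx> v" "u \<in> lists {1..<m}"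
  shows "eval_word (artin_group m) (pres_gen {1..<m} (artin_relations m)) (positive u) =
    eval_word (artin_group m) (pres_gen {1..<m} (artin_relations m)) (positive v)"
proof -
  have "eval_word (artin_group m) (pres_gen {1..<m} (artin_relations m)) (positive l) =
    eval_word (artin_group m) (pres_gen {1..<m} (artin_relations m)) (positive r)"
    if "(l, r) \<in> braid_rels" "l \<in> lists {1..<m}" for l r
    unfolding artin_group_def
    using that braid_rels_letters[OF that(1), of "{1..<m}"]
    by (intro eval_word_gen_relation braid_rels_artin) (simp_all add: positive_words)
  then show ?thesis
    using word_eq_eval[of "artin_group m" "pres_gen {1..<m} (artin_relations m)" "{1..<m}" braid_rels u v]
      braid_rels_letters assms
    by (simp add: artin_group_def group_presented_group pres_gen_closed)
qed

section \<open>Braids that lift a permutation representation\<close>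

text \<open>Coxeter relations for positive words, with \<open>(s t)\<^sup>k = 1\<close> replaced by the equivalent alternating
  relation, which is the form in which words are rewritten.\<close>

definition coxeter_word_rels :: "'i set \<Rightarrow> ('i \<Rightarrow> 'i \<Rightarrow> enat) \<Rightarrow> ('i list \<times> 'i list) set" where
  "coxeter_word_rels I m = {([i, i], []) | i. i \<in> I} \<union>
    {(alt k i j, alt k j i) | i j k. i \<in> I \<and> j \<in> I \<and> i \<noteq> j \<and> m i j = enat k}"

lemma coxeter_word_relE:
  assumes "(l, r) \<in> coxeter_word_rels I m"
  obtains (square) i where "i \<in> I" "l = [i, i]" "r = []"
  | (braid) i j k where "i \<in> I" "j \<in> I" "i \<noteq> j" "m i j = enat k" "l = alt k i j" "r = alt k j i"
  using assms unfolding coxeter_word_rels_def by blast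

lemma square_eq: "i \<in> I \<Longrightarrow> word_eq (coxeter_word_rels I m) (i # i # u) u"
  using word_eq.step[of "[i, i]" "[]" "coxeter_word_rels I m" "[]" u]
  by (auto simp: coxeter_word_rels_def)

lemma alt_eq:
  "i \<in> I \<Longrightarrow> j \<in> I \<Longrightarrow> i \<noteq> j \<Longrightarrow> m i j = enat k \<Longrightarrow>
    word_eq (coxeter_word_rels I m) (alt k i j) (alt k j i)"
  by (rule word_eq_relation) (auto simp: coxeter_word_rels_def)

lemma coxeter_far:
  "i \<in> I \<Longrightarrow> j \<in> I \<Longrightarrow> i \<noteq> j \<Longrightarrow> m i j = 2 \<Longrightarrow> word_eq (coxeter_word_rels I m) [i, j] [j, i]"
  using alt_eq[of i I j m 2] by (simp add: numeral_eq_enat numeral_2_eq_2)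

lemma coxeter_near:
  "i \<in> I \<Longrightarrow> j \<in> I \<Longrightarrow> i \<noteq> j \<Longrightarrow> m i j = 3 \<Longrightarrow>
    word_eq (coxeter_word_rels I m) [i, j, i] [j, i, j]"
  using alt_eq[of i I j m 3] by (simp add: numeral_eq_enat numeral_3_eq_3)

lemma coxeter_double:
  "i \<in> I \<Longrightarrow> j \<in> I \<Longrightarrow> i \<noteq> j \<Longrightarrow> m i j = 4 \<Longrightarrow>
    word_eq (coxeter_word_rels I m) [i, j, i, j] [j, i, j, i]"
  using alt_eq[of i I j m 4] by (simp add: numeral_eq_enat eval_nat_numeral)

text \<open>The data that determine \<open>f\<close> and \<open>e\<close>. Generators are named by an index set \<open>I\<close>, so that types \<open>A\<close> and
  \<open>B\<close> can use intervals of natural numbers as words.\<close>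

locale braid_lift =
  fixes S :: "'a set" and M :: "'a \<Rightarrow> 'a \<Rightarrow> enat"
    and s :: "'i \<Rightarrow> 'a" and I :: "'i set" and F :: "'i \<Rightarrow> nat list" and m :: nat
  assumes matrix: "coxeter_matrix S M"
    and bij: "bij_betw s I S"
    and strands: "i \<in> I \<Longrightarrow> F i \<in> lists {1..<m}"
    and braid: "\<lbrakk>i \<in> I; j \<in> I; i \<noteq> j; M (s i) (s j) = enat k\<rbrakk> \<Longrightarrow>
      concat (map F (alt k i j)) \<approx> concat (map F (alt k j i))"
    and involution: "i \<in> I \<Longrightarrow> perm_of (F i) (perm_of (F i) x) = x"
begin

abbreviation R where "R \<equiv> coxeter_word_rels I (\<lambda>i j. M (s i) (s j))"

abbreviation action :: "'i list \<Rightarrow> nat \<Rightarrow> nat" where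
  "action \<equiv> foldr (\<lambda>i. perm_of (F i))"

lemma action_eq: "word_eq R u v \<Longrightarrow> action u = action v"
proof (erule word_eq_foldr[rotated])
  fix l r assume "(l, r) \<in> R"
  then show "action l = action r"
  proof (cases rule: coxeter_word_relE)
    case (square i)
    then show ?thesis using involution by (simp add: fun_eq_iff)
  next
    case (braid i j k)
    show ?thesis
      unfolding braid(5,6) perm_of_concat[symmetric]
      by (rule perm_of_braid_eq[OF braid_lift.braid[OF braid_lift_axioms braid(1-4)]])
  qed
qed

end

text \<open>Schreier's argument: \<open>c x\<close> is meant as a representative of the coset of elements that carry \<open>x0\<close>
  to \<open>x\<close>, and \<open>B\<close> as a set of generators of the stabilizer of \<open>x0\<close>.\<close>

lemma (in braid_lift) transversal:
  assumes step: "\<And>x i. x \<in> X \<Longrightarrow> i \<in> A \<Longrightarrow> perm_of (F i) x \<in> X \<and>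
      (\<exists>u\<in>lists B. word_eq R (i # c x) (c (perm_of (F i) x) @ u))"
    and base: "x0 \<in> X" "c x0 = []"
  shows "w \<in> lists A \<Longrightarrow> action w x0 \<in> X \<and> (\<exists>u\<in>lists B. word_eq R w (c (action w x0) @ u))"
proof (induction w rule: list.induct)
  case Nil
  show ?case using base by (auto intro!: bexI[of _ "[]"] word_eq.refl)
next
  case (Cons i w)
  let ?y = "action w x0"
  have i: "i \<in> A" and w: "w \<in> lists A" using Cons.prems by auto
  from Cons.IH[OF w] obtain u where u: "?y \<in> X" "u \<in> lists B" "word_eq R w (c ?y @ u)" by blast
  from step[OF u(1) i] obtain v where v: "perm_of (F i) ?y \<in> X" "v \<in> lists B"
    "word_eq R (i # c ?y) (c (perm_of (F i) ?y) @ v)" by blast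
  have "word_eq R (i # w) ((i # c ?y) @ u)"
    using word_eq_Cons[OF u(3)] by simp
  also have "word_eq R \<dots> ((c (perm_of (F i) ?y) @ v) @ u)"
    by (rule word_eq_append[OF v(3) word_eq.refl])
  finally have "word_eq R (i # w) (c (action (i # w) x0) @ v @ u)" by simp
  moreover have "v @ u \<in> lists B" using u v by simp
  moreover have "action (i # w) x0 \<in> X" using v by simp
  ultimately show ?case by blast
qed

lemma (in braid_lift) stabilizer_word:
  assumes step: "\<And>x i. x \<in> X \<Longrightarrow> i \<in> A \<Longrightarrow> perm_of (F i) x \<in> X \<and>
      (\<exists>u\<in>lists B. word_eq R (i # c x) (c (perm_of (F i) x) @ u))"
    and base: "x0 \<in> X" "c x0 = []"
    and w: "w \<in> lists A" "action w = id"
  obtains u where "u \<in> lists B" "word_eq R w u" "action u = id"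
proof -
  obtain u where u: "u \<in> lists B" "word_eq R w (c (action w x0) @ u)"
    using transversal[where X = X and A = A and B = B and c = c, OF step base w(1)] by blast
  then have wu: "word_eq R w u" using base(2) w(2) by simp
  show thesis using that[OF u(1) wu] action_eq[OF wu] w(2) by (simp only:)
qed

locale faithful_braid_lift = braid_lift +
  assumes faithful: "w \<in> lists I \<Longrightarrow> action w = id \<Longrightarrow> word_eq R w []"
begin

lemma matrix_diag: "a \<in> S \<Longrightarrow> M a a = 1"
  using matrix by (simp add: coxeter_matrix_def)

abbreviation "artin_gen \<equiv> pres_gen {1..<m} (artin_relations m)"
abbreviation "cox_gen \<equiv> pres_gen S (coxeter_relations S M)"
abbreviation "artin_word u \<equiv> eval_word (artin_group m) artin_gen (positive u)"

definition lift :: "'a \<Rightarrow> nat word set" where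
  "lift a = artin_word (F (inv_into I s a))"

definition perm :: "'a \<Rightarrow> nat \<Rightarrow> nat" where
  "perm a = perm_of (F (inv_into I s a))"

lemma s_in: "i \<in> I \<Longrightarrow> s i \<in> S" using bij by (auto simp: bij_betw_def)
lemma inv_s: "i \<in> I \<Longrightarrow> inv_into I s (s i) = i" using bij by (simp add: bij_betw_def)
lemma inv_in: "a \<in> S \<Longrightarrow> inv_into I s a \<in> I" using bij by (auto simp: bij_betw_def inv_into_into)

lemma groups: "group (artin_group m)" "group (sym_group m)" "group (coxeter_group S M)" "group (braid_group S M)"
  by (simp_all add: artin_group_def coxeter_group_def braid_group_def group_presented_group sym_group_is_group)

lemma artin_gen_closed: "artin_gen \<in> {1..<m} \<rightarrow> carrier (artin_group m)"
  by (simp add: artin_group_def pres_gen_closed)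

lemma cox_gen_closed: "cox_gen \<in> S \<rightarrow> carrier (coxeter_group S M)"
  by (simp add: coxeter_group_def pres_gen_closed)

lemma lift_closed: "lift \<in> S \<rightarrow> carrier (artin_group m)"
  unfolding lift_def
  by (intro Pi_I eval_word_closed[OF groups(1) artin_gen_closed]) (simp only: positive_words strands inv_in)

lemma perm_closed: "perm \<in> S \<rightarrow> carrier (sym_group m)"
  unfolding perm_def by (intro Pi_I) (simp only: sym_group_carrier perm_of_permutes strands inv_in)

lemma artin_proj_lift: "a \<in> S \<Longrightarrow> artin_proj m (lift a) = perm a"
  unfolding lift_def perm_def by (intro artin_proj_eval strands inv_in)

lemma eval_lift:
  assumes "u \<in> lists I"
  shows "eval_word (artin_group m) lift (positive (map s u)) = artin_word (concat (map F u))"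
proof -
  have "eval_word (artin_group m) lift (positive (map s u)) =
      eval_word (artin_group m) (\<lambda>i. artin_word (F i)) (positive u)"
    unfolding eval_word_map
    by (rule eval_word_letters_cong[of I])
      (simp_all only: positive_words assms comp_def lift_def inv_s)
  also have "\<dots> = artin_word (concat (map F u))"
    by (rule eval_word_concat[OF groups(1) artin_gen_closed strands assms])
  finally show ?thesis .
qed

lemma eval_perm:
  assumes "u \<in> lists I"
  shows "eval_word (sym_group m) perm (positive (map s u)) = action u"
proof -
  have "eval_word (sym_group m) perm (positive (map s u)) =
      eval_word (sym_group m) (\<lambda>i. perm_of (F i)) (positive u)"
    unfolding eval_word_map
    by (rule eval_word_letters_cong[of I])
      (simp_all only: positive_words assms comp_def perm_def inv_s)
  then show ?thesis by (simp only: eval_word_sym_group perm_of_concat)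
qed

lemma eval_perm_lift:
  "w \<in> words S \<Longrightarrow> artin_proj m (eval_word (artin_group m) lift w) = eval_word (sym_group m) perm w"
proof -
  assume w: "w \<in> words S"
  have "artin_proj m \<in> hom (artin_group m) (sym_group m)"
    using artin_proj_epi by (simp add: epi_def)
  from eval_word_hom[OF groups(1,2) this lift_closed w]
  show ?thesis
    using eval_word_letters_cong[of S "artin_proj m \<circ> lift" perm w "sym_group m"] w
    by (simp add: artin_proj_lift)
qed

lemma braid_relationE:
  assumes "(l, r) \<in> braid_relations S M"
  obtains i j k where "i \<in> I" "j \<in> I" "i \<noteq> j" "M (s i) (s j) = enat k"
    "l = positive (map s (alt k i j))" "r = positive (map s (alt k j i))"
proof -
  obtain a b k where ab: "a \<in> S" "b \<in> S" "a \<noteq> b" "M a b = enat k" "l = alternating k a b" "r = alternating k b a"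
    using assms unfolding braid_relations_def by blast
  have S: "S = s ` I" using bij by (simp add: bij_betw_def)
  obtain i j where "i \<in> I" "j \<in> I" "a = s i" "b = s j" using ab(1,2) unfolding S by blast
  then show ?thesis using ab by (intro that[of i j k]) (auto simp: alternating_alt map_alt simp del: map_map)
qed

lemma lift_respects:
  "\<forall>(l, r)\<in>braid_relations S M. eval_word (artin_group m) lift l = eval_word (artin_group m) lift r"
proof clarify
  fix l r assume "(l, r) \<in> braid_relations S M"
  then obtain i j k where ij: "i \<in> I" "j \<in> I" "i \<noteq> j" "M (s i) (s j) = enat k"
    and lr: "l = positive (map s (alt k i j))" "r = positive (map s (alt k j i))"
    by (rule braid_relationE)
  have "concat (map F (alt k i j)) \<in> lists {1..<m}"
    using strands alt_in_lists[OF ij(1,2), of k] by fastforce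
  then show "eval_word (artin_group m) lift l = eval_word (artin_group m) lift r"
    unfolding lr eval_lift[OF alt_in_lists[OF ij(1,2)]] eval_lift[OF alt_in_lists[OF ij(2,1)]]
    by (rule braid_eq_artin[OF braid[OF ij]])
qed

lemma braid_relation_words: "(l, r) \<in> braid_relations S M \<Longrightarrow> l \<in> words S \<and> r \<in> words S"
  by (erule braid_relationE)
    (simp only: map_alt alt_in_lists s_in mem_Sigma_iff UNIV_I simp_thms)

lemma perm_respects:
  "\<forall>(l, r)\<in>coxeter_relations S M. eval_word (sym_group m) perm l = eval_word (sym_group m) perm r"
proof (rule coxeter_relations_respected[OF groups(2) perm_closed])
  show "perm a \<otimes>\<^bsub>sym_group m\<^esub> perm a = \<one>\<^bsub>sym_group m\<^esub>" if "a \<in> S" for a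
    using involution[OF inv_in[OF that]] by (auto simp: sym_group_def perm_def)
  show "\<forall>(l, r)\<in>braid_relations S M. eval_word (sym_group m) perm l = eval_word (sym_group m) perm r"
    using lift_respects braid_relation_words by (fastforce simp flip: eval_perm_lift)
qed (rule matrix_diag)

definition f where "f = pres_lift (artin_group m) lift"
definition e where "e = pres_lift (sym_group m) perm"

lemma f_hom: "f \<in> hom (braid_group S M) (artin_group m)"
  unfolding f_def braid_group_def by (rule pres_lift_hom[OF groups(1) lift_closed lift_respects])

lemma e_hom: "e \<in> hom (coxeter_group S M) (sym_group m)"
  unfolding e_def coxeter_group_def by (rule pres_lift_hom[OF groups(2) perm_closed perm_respects])

lemma e_class: "w \<in> words S \<Longrightarrow> e (pres_rel S (coxeter_relations S M) `` {w}) = eval_word (sym_group m) perm w"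
  unfolding e_def by (rule pres_lift_class[OF groups(2) perm_closed perm_respects])

lemma diagram_commutes: "x \<in> carrier (braid_group S M) \<Longrightarrow> artin_proj m (f x) = e (braid_proj S M x)"
proof -
  assume "x \<in> carrier (braid_group S M)"
  then obtain w where w: "w \<in> words S" "x = pres_rel S (braid_relations S M) `` {w}"
    unfolding braid_group_def by (rule presented_group_carrierE)
  have "braid_proj S M x = pres_rel S (coxeter_relations S M) `` {w}"
    unfolding w(2) braid_proj_def
      pres_lift_class[OF groups(3) cox_gen_closed braid_relations_respected[OF matrix] w(1)]
    using w(1) by (simp only: coxeter_group_def eval_word_gen)
  moreover have "f x = eval_word (artin_group m) lift w"
    unfolding w(2) f_def by (rule pres_lift_class[OF groups(1) lift_closed lift_respects w(1)])
  ultimately show ?thesis using w(1) by (simp only: e_class eval_perm_lift)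
qed

text \<open>Inverse letters can be dropped because the generators of a Coxeter group are involutions.\<close>

lemma coxeter_positive:
  assumes "w \<in> words S"
  obtains u where "u \<in> lists I"
    "pres_rel S (coxeter_relations S M) `` {w} = eval_word (coxeter_group S M) (cox_gen \<circ> s) (positive u)"
proof -
  have "\<exists>u\<in>lists I. eval_word (coxeter_group S M) cox_gen w = eval_word (coxeter_group S M) (cox_gen \<circ> s) (positive u)"
    using assms
  proof (induction w rule: list.induct)
    case Nil
    then show ?case by (intro bexI[of _ "[]"]) auto
  next
    case (Cons x w)
    obtain a b where x: "x = (a, b)" by (cases x)
    have a: "a \<in> S" using Cons.prems x by simp
    interpret group "coxeter_group S M" by (rule groups)
    have "cox_gen a \<in> carrier (coxeter_group S M)" using cox_gen_closed a by auto
    then have "inv\<^bsub>coxeter_group S M\<^esub> (cox_gen a) = cox_gen a"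
      using coxeter_gen_involution[OF matrix a] inv_equality by blast
    moreover have "s (inv_into I s a) = a" using bij a by (simp add: bij_betw_inv_into_right)
    moreover have "w \<in> words S" using Cons.prems by simp
    from Cons.IH[OF this] obtain u where "u \<in> lists I"
      "eval_word (coxeter_group S M) cox_gen w = eval_word (coxeter_group S M) (cox_gen \<circ> s) (positive u)"
      by blast
    ultimately show ?case
      using x inv_in[OF a] by (intro bexI[of _ "inv_into I s a # u"]) (auto simp: comp_def)
  qed
  then show ?thesis
    using that assms eval_word_gen[of w S "coxeter_relations S M"] by (auto simp: coxeter_group_def)
qed

lemma word_eq_coxeter:
  assumes "word_eq R u v" "u \<in> lists I"
  shows "eval_word (coxeter_group S M) (cox_gen \<circ> s) (positive u) =
    eval_word (coxeter_group S M) (cox_gen \<circ> s) (positive v)"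
proof -
  have closed: "cox_gen \<circ> s \<in> I \<rightarrow> carrier (coxeter_group S M)"
    using cox_gen_closed s_in by auto
  have "(u \<in> lists I \<longleftrightarrow> v \<in> lists I) \<and> (u \<in> lists I \<longrightarrow>
    eval_word (coxeter_group S M) (cox_gen \<circ> s) (positive u) =
    eval_word (coxeter_group S M) (cox_gen \<circ> s) (positive v))"
  proof (rule word_eq_eval[OF groups(3) closed _ _ assms(1)])
    fix l r assume lr: "(l, r) \<in> R"
    then show "l \<in> lists I \<longleftrightarrow> r \<in> lists I"
      by (cases rule: coxeter_word_relE) (auto simp: alt_in_lists simp del: in_lists_conv_set)
    show "eval_word (coxeter_group S M) (cox_gen \<circ> s) (positive l) =
        eval_word (coxeter_group S M) (cox_gen \<circ> s) (positive r)"
      using lr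
    proof (cases rule: coxeter_word_relE)
      case (square i)
      interpret group "coxeter_group S M" by (rule groups)
      show ?thesis
        using square coxeter_gen_involution[OF matrix, of "s i"] s_in cox_gen_closed by (auto simp: Pi_iff)
    next
      case (braid i j k)
      have "s i \<noteq> s j" using braid bij by (auto simp: bij_betw_def inj_on_def)
      then have "(alternating k (s i) (s j), alternating k (s j) (s i)) \<in> braid_relations S M"
        using braid s_in unfolding braid_relations_def by blast
      then have "eval_word (coxeter_group S M) cox_gen (alternating k (s i) (s j)) =
          eval_word (coxeter_group S M) cox_gen (alternating k (s j) (s i))"
        using braid_relations_respected[OF matrix] by blast
      then show ?thesis
        unfolding braid(5,6) by (simp only: alternating_alt flip: eval_word_map map_alt)
    qed
  qed
  then show ?thesis using assms(2) by blast
qed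

lemma e_mon: "e \<in> mon (coxeter_group S M) (sym_group m)"
proof -
  interpret group_hom "coxeter_group S M" "sym_group m" e
    using groups e_hom by (simp add: group_hom_def group_hom_axioms_def)
  have "x = \<one>\<^bsub>coxeter_group S M\<^esub>"
    if x: "x \<in> carrier (coxeter_group S M)" "e x = \<one>\<^bsub>sym_group m\<^esub>" for x
  proof -
    obtain w where w: "w \<in> words S" "x = pres_rel S (coxeter_relations S M) `` {w}"
      using x(1) unfolding coxeter_group_def by (rule presented_group_carrierE)
    obtain u where u: "u \<in> lists I" "x = eval_word (coxeter_group S M) (cox_gen \<circ> s) (positive u)"
      using coxeter_positive[OF w(1)] w(2) by metis
    have su: "positive (map s u) \<in> words S" using u(1) s_in by (auto simp: positive_words)
    have "x = pres_rel S (coxeter_relations S M) `` {positive (map s u)}"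
      unfolding u(2) eval_word_map[symmetric] unfolding coxeter_group_def eval_word_gen[OF su] ..
    then have "e x = action u" using e_class[OF su] eval_perm[OF u(1)] by simp
    then have "action u = id" using x(2) by (simp add: sym_group_def)
    from word_eq_coxeter[OF faithful[OF u(1) this] u(1)] u(2) show ?thesis by simp
  qed
  then show ?thesis using e_hom inj_on_one_iff by (auto simp: mon_def)
qed

lemma diagram:
  "\<exists>m e f.
    e \<in> mon (coxeter_group S M) (sym_group m) \<and>
    f \<in> hom (braid_group S M) (artin_group m) \<and>
    restrict f (carrier (pure_braid_group S M)) \<in> hom (pure_braid_group S M) (pure_artin_group m) \<and>
    short_exact (pure_braid_group S M) id (braid_group S M) (braid_proj S M) (coxeter_group S M) \<and>
    short_exact (pure_artin_group m) id (artin_group m) (artin_proj m) (sym_group m) \<and>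
    (\<forall>x\<in>carrier (braid_group S M). artin_proj m (f x) = e (braid_proj S M x))"
proof (intro exI conjI ballI)
  show "e \<in> mon (coxeter_group S M) (sym_group m)" by (rule e_mon)
  show "f \<in> hom (braid_group S M) (artin_group m)" by (rule f_hom)
  show "short_exact (pure_braid_group S M) id (braid_group S M) (braid_proj S M) (coxeter_group S M)"
    unfolding pure_braid_group_def by (rule short_exact_kernel[OF groups(4,3) braid_proj_epi[OF matrix]])
  show "short_exact (pure_artin_group m) id (artin_group m) (artin_proj m) (sym_group m)"
    unfolding pure_artin_group_def by (rule short_exact_kernel[OF groups(1,2) artin_proj_epi])
  show "artin_proj m (f x) = e (braid_proj S M x)" if "x \<in> carrier (braid_group S M)" for x
    by (rule diagram_commutes[OF that])
  have "e \<one>\<^bsub>coxeter_group S M\<^esub> = \<one>\<^bsub>sym_group m\<^esub>" by (rule hom_one[OF e_hom groups(3,2)])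
  moreover have "x \<otimes>\<^bsub>braid_group S M\<^esub> y \<in> kernel (braid_group S M) (coxeter_group S M) (braid_proj S M)"
    if "x \<in> kernel (braid_group S M) (coxeter_group S M) (braid_proj S M)"
      "y \<in> kernel (braid_group S M) (coxeter_group S M) (braid_proj S M)" for x y
  proof -
    interpret group_hom "braid_group S M" "coxeter_group S M" "braid_proj S M"
      using groups braid_proj_epi[OF matrix] by (simp add: group_hom_def group_hom_axioms_def epi_def)
    show ?thesis using subgroup.m_closed[OF subgroup_kernel that] .
  qed
  ultimately show "restrict f (carrier (pure_braid_group S M)) \<in> hom (pure_braid_group S M) (pure_artin_group m)"
    using f_hom diagram_commutes
    by (auto simp: pure_braid_group_def pure_artin_group_def hom_def kernel_def)
qed

end

section \<open>Type A\<close>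

text \<open>For the generators \<open>1..q\<close>, acting on the points \<open>1..q + 1\<close>, the representative of the point \<open>x\<close> is
  the ascending word \<open>x (x + 1) \<dots> q\<close>, which carries \<open>q + 1\<close> to \<open>x\<close>. Multiplied by a generator, it becomes
  another representative or lets the generator pass, possibly lowered by one, so that only generators
  below \<open>q\<close> remain on the right.\<close>

lemma type_A_lift:
  assumes "coxeter_type_A n S M"
  obtains s :: "nat \<Rightarrow> 'a" and I F m where "faithful_braid_lift S M s I F m"
proof -
  obtain s where M: "coxeter_matrix S M" and bij: "bij_betw s {1..n} S"
    and near: "\<And>i. 1 \<le> i \<Longrightarrow> i + 1 \<le> n \<Longrightarrow> M (s i) (s (i + 1)) = 3"
    and far: "\<And>i j. 1 \<le> i \<Longrightarrow> i + 2 \<le> j \<Longrightarrow> j \<le> n \<Longrightarrow> M (s i) (s j) = 2"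
    using assms unfolding coxeter_type_A_def by blast
  have sym: "M (s i) (s j) = M (s j) (s i)" if "i \<in> {1..n}" "j \<in> {1..n}" for i j
    using M bij that unfolding coxeter_matrix_def bij_betw_def by blast
  let ?F = "\<lambda>i::nat. [i]"
  have braid: "concat (map ?F (alt k i j)) \<approx> concat (map ?F (alt k j i))"
    if "i \<in> {1..n}" "j \<in> {1..n}" "i < j" "M (s i) (s j) = enat k" for i j k
  proof (cases "j = Suc i")
    case True
    then have "k = 3" using near[of i] that by (simp add: numeral_eq_enat)
    then show ?thesis using True braid_near[of i] by (simp add: numeral_3_eq_3)
  next
    case False
    then have "k = 2" using far[of i j] that by (simp add: numeral_eq_enat)
    then show ?thesis using False that(3) braid_far[of i j] by (simp add: numeral_2_eq_2)
  qed
  interpret braid_lift S M s "{1..n}" ?F "n + 1"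
  proof
    fix i j k assume ij: "i \<in> {1..n}" "j \<in> {1..n}" "i \<noteq> j" "M (s i) (s j) = enat k"
    show "concat (map ?F (alt k i j)) \<approx> concat (map ?F (alt k j i))"
    proof (cases "i < j")
      case True
      then show ?thesis by (rule braid[OF ij(1,2) _ ij(4)])
    next
      case False
      then show ?thesis using ij sym[OF ij(1,2)] by (intro word_eq.sym[OF braid]) auto
    qed
  qed (use M bij in auto)
  have R_far: "word_eq R [i, j] [j, i]" "word_eq R [j, i] [i, j]"
    if "1 \<le> i" "i + 2 \<le> j" "j \<le> n" for i j
    using that far[of i j] sym[of i j] by (auto intro!: coxeter_far)
  have R_near: "word_eq R [Suc i, i, Suc i] [i, Suc i, i]" if "1 \<le> i" "Suc i \<le> n" for i
    using that near[of i] sym[of i "Suc i"] by (auto intro!: coxeter_near)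
  have "word_eq R w []" if "l \<le> n" "w \<in> lists {1..l}" "action w = id" for l w
    using that
  proof (induction l arbitrary: w)
    case 0
    then show ?case by (cases w) (auto intro: word_eq.refl)
  next
    case (Suc q)
    let ?c = "\<lambda>x. [x..<Suc (Suc q)]"
    have step: "perm_of [i] x \<in> {1..q + 2} \<and>
      (\<exists>u\<in>lists {1..q}. word_eq R (i # ?c x) (?c (perm_of [i] x) @ u))"
      if x: "x \<in> {1..q + 2}" and i: "i \<in> {1..Suc q}" for x i
    proof -
      consider "x = Suc i" | "x = i" | "x < i" | "i + 1 < x" by linarith
      then show ?thesis
      proof cases
        case 1
        then have "i # ?c x = ?c i" using i by (simp add: upt_conv_Cons del: upt_Suc)
        then show ?thesis using 1 i
          by (intro conjI bexI[of _ "[]"]) (auto simp: word_eq.refl simp del: upt_Suc)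
      next
        case 2
        then have "i # ?c x = i # i # ?c (Suc i)" using i by (simp add: upt_conv_Cons del: upt_Suc)
        moreover have "word_eq R \<dots> (?c (Suc i))" by (rule square_eq) (use i Suc.prems in auto)
        ultimately show ?thesis using 2 i
          by (intro conjI bexI[of _ "[]"]) (auto simp del: upt_Suc)
      next
        case 3
        have "word_eq R (i # ?c x) (?c x @ [i - 1])"
          by (rule slide_ascending) (use 3 x i Suc.prems R_far R_near[of "i - 1"] in auto)
        moreover have "perm_of [i] x = x" using 3 by (simp add: transpose_def)
        ultimately show ?thesis using 3 x i by (intro conjI bexI[of _ "[i - 1]"]) auto
      next
        case 4
        have "word_eq R (i # ?c x) (?c x @ [i])"
          by (rule word_eq_commute1) (use 4 x i Suc.prems R_far in auto)
        moreover have "perm_of [i] x = x" using 4 by (simp add: transpose_def)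
        ultimately show ?thesis using 4 x i by (intro conjI bexI[of _ "[i]"]) auto
      qed
    qed
    obtain u where "u \<in> lists {1..q}" "word_eq R w u" "action u = id"
      by (rule stabilizer_word[of "{1..q + 2}" "{1..Suc q}" "{1..q}" ?c "q + 2" w])
        (use step Suc.prems in auto)
    then show ?case using Suc by (blast intro: word_eq.trans Suc_leD)
  qed
  then have "faithful_braid_lift S M s {1..n} ?F (n + 1)"
    by unfold_locales auto
  then show thesis by (rule that)
qed

section \<open>Type B\<close>

text \<open>The points \<open>n + j\<close> and \<open>n + 1 - j\<close> play the part of \<open>j\<close> and \<open>-j\<close> in a signed permutation.\<close>

definition mirrored :: "nat \<Rightarrow> nat \<Rightarrow> nat list" where
  "mirrored n i = (if i = 1 then [n] else [n + 1 - i, n + i - 1])"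

lemma perm_mirrored_upper:
  assumes "1 \<le> i" "i \<le> n" "1 \<le> j" "j \<le> n"
  shows "perm_of (mirrored n i) (n + j) =
    (if i = j + 1 then n + j + 1 else if i = j then (if j = 1 then n else n + j - 1) else n + j)"
proof (cases "i = 1")
  case True
  then show ?thesis using assms by (simp add: mirrored_def transpose_def)
next
  case False
  obtain d where d: "i = Suc d" using assms(1) by (cases i) auto
  then have F: "mirrored n i = [n - d, n + d]" using False by (simp add: mirrored_def)
  have low: "transpose (n - d) (n - d + 1) (n + k) = n + k" if "1 \<le> k" for k
    using that assms d False by (intro transpose_apply_other) linarith+
  consider "j = d" | "j = Suc d" | "j \<noteq> d" "j \<noteq> Suc d" by blast
  then show ?thesis
  proof cases
    case 1
    then show ?thesis using low[of "Suc d"] d F by simp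
  next
    case 2
    then show ?thesis using low[of d] d False F by simp
  next
    case 3
    then show ?thesis using low[of j] d F assms by (simp add: transpose_apply_other)
  qed
qed

lemma perm_mirrored_lower:
  assumes "1 \<le> i" "i \<le> n" "1 \<le> j" "j \<le> n"
  shows "perm_of (mirrored n i) (n + 1 - j) =
    (if i = j + 1 then n - j else if i = j then (if j = 1 then n + 1 else n + 2 - j) else n + 1 - j)"
proof (cases "i = 1")
  case True
  show ?thesis
  proof (cases "j = 1")
    case False
    then have "transpose n (n + 1) (n + 1 - j) = n + 1 - j"
      using assms by (intro transpose_apply_other) linarith+
    then show ?thesis using True False assms by (simp add: mirrored_def)
  qed (use True in \<open>simp add: mirrored_def\<close>)
next
  case False
  obtain d where d: "i = Suc d" using assms(1) by (cases i) auto
  then have F: "mirrored n i = [n - d, n + d]" using False by (simp add: mirrored_def)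
  have high: "transpose (n + d) (n + d + 1) (n + 1 - j) = n + 1 - j"
    using assms d False by (intro transpose_apply_other) linarith+
  consider "j = d" | "j = Suc d" | "j \<noteq> d" "j \<noteq> Suc d" by blast
  then show ?thesis
  proof cases
    case 1
    then have "n + 1 - j = n - d + 1" using assms by linarith
    then show ?thesis using 1 high d F by simp
  next
    case 2
    then have "n + 1 - j = n - d" "n + 2 - j = n - d + 1" using assms d by linarith+
    then show ?thesis using 2 high d False F by simp
  next
    case 3
    then have "transpose (n - d) (n - d + 1) (n + 1 - j) = n + 1 - j"
      using assms d by (intro transpose_apply_other) linarith+
    then show ?thesis using 3 high d F by simp
  qed
qed

lemma mirrored_far:
  assumes "1 \<le> i" "i + 2 \<le> j" "j \<le> n"
  shows "mirrored n i @ mirrored n j \<approx> mirrored n j @ mirrored n i"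
  by (rule braid_commute) (use assms in \<open>auto simp: mirrored_def split: if_splits\<close>)

lemma mirrored_involution:
  assumes "1 \<le> i" "i \<le> n"
  shows "perm_of (mirrored n i) (perm_of (mirrored n i) x) = x"
  by (rule far_word_involution) (use assms in \<open>auto simp: mirrored_def\<close>)

text \<open>The two halves of the generators lie far apart, so the relation separates into a braid relation
  on the left and one on the right.\<close>

lemma mirrored_near:
  assumes "2 \<le> i" "i + 1 \<le> n"
  shows "mirrored n i @ mirrored n (i + 1) @ mirrored n i \<approx> mirrored n (i + 1) @ mirrored n i @ mirrored n (i + 1)"
proof -
  define p where "p = n - i"
  define q where "q = n + i - 1"
  have far: "p + 3 \<le> q" using assms by (simp add: p_def q_def)
  have f: "mirrored n i = [Suc p, q]" "mirrored n (i + 1) = [p, Suc q]"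
    using assms by (auto simp: mirrored_def p_def q_def)
  have shuffle: "[a, b] @ [a', b'] @ [a, b] \<approx> [a, a', a] @ [b, b', b]"
    if "{a, a'} \<subseteq> {p, Suc p}" "{b, b'} \<subseteq> {q, Suc q}" for a b a' b'
  proof -
    have "[a, b] @ [a', b'] @ [a, b] = [a] @ [b] @ [a'] @ [b', a, b]" by simp
    also have "\<dots> \<approx> [a] @ [a'] @ [b] @ [b', a, b]"
      by (rule braid_commute_pair) (use that far in auto)
    also have "\<dots> = [a, a'] @ [b, b'] @ [a] @ [b]" by simp
    also have "\<dots> \<approx> [a, a'] @ [a] @ [b, b'] @ [b]"
      by (rule braid_commute_pair) (use that far in auto)
    finally show ?thesis by simp
  qed
  have "mirrored n i @ mirrored n (i + 1) @ mirrored n i \<approx> [Suc p, p, Suc p] @ [q, Suc q, q]"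
    unfolding f by (rule shuffle) auto
  also have "\<dots> \<approx> [p, Suc p, p] @ [Suc q, q, Suc q]"
    by (intro word_eq_append braid_near word_eq.sym[OF braid_near])
  also have "\<dots> \<approx> mirrored n (i + 1) @ mirrored n i @ mirrored n (i + 1)"
    unfolding f by (rule word_eq.sym[OF shuffle]) auto
  finally show ?thesis .
qed

text \<open>The half twist on four strands, written as the two alternating products of the middle generator
  and the product of the outer two.\<close>

lemma mirrored_double:
  assumes "2 \<le> n"
  shows "mirrored n 1 @ mirrored n 2 @ mirrored n 1 @ mirrored n 2 \<approx>
    mirrored n 2 @ mirrored n 1 @ mirrored n 2 @ mirrored n 1"
proof -
  obtain p where n: "n = Suc p" using assms by (cases n) auto
  let ?q = "Suc (Suc p)"
  have f: "mirrored n 1 = [n]" "mirrored n 2 = [p, ?q]" by (auto simp: mirrored_def n)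
  have far: "a @ [p] @ [?q] @ b \<approx> a @ [?q] @ [p] @ b" for a b
    by (rule braid_commute_pair) auto
  have near1: "a @ [p, n, p] @ b \<approx> a @ [n, p, n] @ b" for a b
    unfolding n by (rule word_eq_context[OF braid_near])
  have near2: "a @ [n, ?q, n] @ b \<approx> a @ [?q, n, ?q] @ b" for a b
    unfolding n by (rule word_eq_context[OF braid_near])
  have "[n, p, ?q, n, p, ?q] \<approx> [n, ?q, p, n, p, ?q]" using far[of "[n]" "[n, p, ?q]"] by simp
  also have "\<dots> \<approx> [n, ?q, n, p, n, ?q]" using near1[of "[n, ?q]" "[?q]"] by simp
  also have "\<dots> \<approx> [?q, n, ?q, p, n, ?q]" using near2[of "[]" "[p, n, ?q]"] by simp
  also have "\<dots> \<approx> [?q, n, p, ?q, n, ?q]" using word_eq.sym[OF far[of "[?q, n]" "[n, ?q]"]] by simp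
  also have "\<dots> \<approx> [?q, n, p, n, ?q, n]" using word_eq.sym[OF near2[of "[?q, n, p]" "[]"]] by simp
  also have "\<dots> \<approx> [?q, p, n, p, ?q, n]" using word_eq.sym[OF near1[of "[?q]" "[?q, n]"]] by simp
  also have "\<dots> \<approx> [p, ?q, n, p, ?q, n]" using word_eq.sym[OF far[of "[]" "[n, p, ?q, n]"]] by simp
  finally show ?thesis unfolding f by simp
qed

text \<open>The generators \<open>1..q\<close> permute the points \<open>n + 1 - q..n + q\<close> transitively. The representative of
  \<open>n + j\<close> is the ascending word \<open>(j + 1) \<dots> q\<close>; for a point \<open>n + 1 - j\<close> below the middle it first
  descends, as \<open>j \<dots> 2 1 2 \<dots> q\<close>. The stabilizer of \<open>n + q\<close> is again generated by the generators below
  \<open>q\<close>. The relation of order four is used only when the generator \<open>1\<close> is moved across \<open>2 1 2\<close>.\<close>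

lemma type_B_lift:
  assumes n: "2 \<le> n" and "coxeter_type_B n S M"
  obtains s :: "nat \<Rightarrow> 'a" and I F m where "faithful_braid_lift S M s I F m"
proof -
  obtain s where M: "coxeter_matrix S M" and bij: "bij_betw s {1..n} S"
    and double: "M (s 1) (s 2) = 4"
    and near: "\<And>i. 2 \<le> i \<Longrightarrow> i + 1 \<le> n \<Longrightarrow> M (s i) (s (i + 1)) = 3"
    and far: "\<And>i j. 1 \<le> i \<Longrightarrow> i + 2 \<le> j \<Longrightarrow> j \<le> n \<Longrightarrow> M (s i) (s j) = 2"
    using assms unfolding coxeter_type_B_def by blast
  have sym: "M (s i) (s j) = M (s j) (s i)" if "i \<in> {1..n}" "j \<in> {1..n}" for i j
    using M bij that unfolding coxeter_matrix_def bij_betw_def by blast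
  let ?F = "mirrored n"
  have braid: "concat (map ?F (alt k i j)) \<approx> concat (map ?F (alt k j i))"
    if "i \<in> {1..n}" "j \<in> {1..n}" "i < j" "M (s i) (s j) = enat k" for i j k
  proof -
    have "i = 1 \<and> j = 2 \<or> 2 \<le> i \<and> j = Suc i \<or> i + 2 \<le> j" using that by auto
    then consider "i = 1" "j = 2" | "2 \<le> i" "j = Suc i" | "i + 2 \<le> j" by blast
    then show ?thesis
    proof cases
      case 1
      then have "k = 4" using double that by (simp add: numeral_eq_enat)
      then show ?thesis using 1 mirrored_double[OF n] by (simp add: eval_nat_numeral)
    next
      case 2
      then have "k = 3" using near[of i] that by (simp add: numeral_eq_enat)
      then show ?thesis using 2 that mirrored_near[of i n] by (simp add: numeral_3_eq_3)
    next
      case 3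
      then have "k = 2" using far[of i j] that by (simp add: numeral_eq_enat)
      then show ?thesis using 3 that mirrored_far[of i j n] by (simp add: numeral_2_eq_2)
    qed
  qed
  interpret braid_lift S M s "{1..n}" ?F "2 * n"
  proof
    fix i j k assume ij: "i \<in> {1..n}" "j \<in> {1..n}" "i \<noteq> j" "M (s i) (s j) = enat k"
    show "concat (map ?F (alt k i j)) \<approx> concat (map ?F (alt k j i))"
    proof (cases "i < j")
      case True
      then show ?thesis by (rule braid[OF ij(1,2) _ ij(4)])
    next
      case False
      then show ?thesis using ij sym[OF ij(1,2)] by (intro word_eq.sym[OF braid]) auto
    qed
  next
    fix i x assume "i \<in> {1..n}"
    then show "perm_of (?F i) (perm_of (?F i) x) = x"
      by (intro mirrored_involution) auto
  next
    fix i assume "i \<in> {1..n}"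
    then show "?F i \<in> lists {1..<2 * n}" by (auto simp: mirrored_def)
  qed (use M bij in auto)
  have R_far: "word_eq R [i, j] [j, i]" "word_eq R [j, i] [i, j]"
    if "1 \<le> i" "i + 2 \<le> j" "j \<le> n" for i j
    using that far[of i j] sym[of i j] by (auto intro!: coxeter_far)
  have R_near: "word_eq R [Suc i, i, Suc i] [i, Suc i, i]" "word_eq R [i, Suc i, i] [Suc i, i, Suc i]"
    if "2 \<le> i" "Suc i \<le> n" for i
    using that near[of i] sym[of i "Suc i"] by (auto intro!: coxeter_near)
  have R_double: "word_eq R [1, 2, 1, 2] [2, 1, 2, 1]"
    by (rule coxeter_double) (use n double in auto)
  have "word_eq R w []" if "l \<le> n" "w \<in> lists {1..l}" "action w = id" for l w
    using that
  proof (induction l arbitrary: w)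
    case 0
    then show ?case by (cases w) (auto intro: word_eq.refl)
  next
    case (Suc l)
    define q where "q = Suc l"
    have q: "1 \<le> q" "q \<le> n" "l = q - 1" using Suc.prems by (auto simp: q_def)
    define up where "up = (\<lambda>j. [Suc j..<Suc q])"
    define down where "down = (\<lambda>j. rev [2..<Suc j] @ [1..<Suc q])"
    define c where "c = (\<lambda>x. if n < x then up (x - n) else down (n + 1 - x))"
    have c_up: "c (n + j) = up j" and c_down: "c (n + 1 - j) = down j" if "1 \<le> j" "j \<le> q" for j
      using that q by (auto simp: c_def)
    define X where "X = {n + 1 - q..n + q}"
    have up_Cons: "up j = Suc j # up (Suc j)" if "j < q" for j
      using that by (simp add: up_def upt_conv_Cons del: upt_Suc)
    have down_Suc: "down (Suc j) = Suc j # down j" if "1 \<le> j" for j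
      using that by (simp add: down_def)
    have down_1: "down 1 = 1 # up 1"
      using q by (simp add: down_def up_def upt_conv_Cons del: upt_Suc)
    have slide_up: "word_eq R (i # up j) (up j @ [i - 1])" if "Suc j < i" "i \<le> q" "2 \<le> i - 1" for i j
      unfolding up_def by (rule slide_ascending) (use that q R_far R_near(1)[of "i - 1"] in auto)
    have step_up: "perm_of (?F i) (n + j) \<in> X \<and>
        (\<exists>u\<in>lists {1..l}. word_eq R (i # c (n + j)) (c (perm_of (?F i) (n + j)) @ u))"
      if j: "1 \<le> j" "j \<le> q" and i: "i \<in> {1..q}" for i j
    proof -
      have perm: "perm_of (?F i) (n + j) =
        (if i = j + 1 then n + j + 1 else if i = j then (if j = 1 then n else n + j - 1) else n + j)"
        by (rule perm_mirrored_upper) (use i j q in auto)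
      consider "i = j + 1" | "i = j" "j = 1" | "i = j" "j \<ge> 2" | "i < j" | "i > j + 1"
        using j by linarith
      then show ?thesis
      proof cases
        case 1
        then have "i # up j = i # i # up (j + 1)" using i up_Cons[of j] by simp
        moreover have "word_eq R \<dots> (up (j + 1))" by (rule square_eq) (use i q in auto)
        ultimately show ?thesis unfolding perm using 1 i j c_up[of j] c_up[of "j + 1"]
          by (intro conjI bexI[of _ "[]"]) (auto simp: X_def)
      next
        case 2
        then have "i # up j = down 1" using down_1 by simp
        then show ?thesis unfolding perm using 2 i j c_up[of j] c_down[of 1]
          by (intro conjI bexI[of _ "[]"]) (auto simp: X_def word_eq.refl)
      next
        case 3
        then have "i # up j = up (j - 1)" using up_Cons[of "j - 1"] j by simp
        moreover have "n + (j - 1) = n + j - 1" using 3 by simp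
        ultimately show ?thesis unfolding perm using 3 i j c_up[of j] c_up[of "j - 1"]
          by (intro conjI bexI[of _ "[]"]) (auto simp: X_def word_eq.refl)
      next
        case 4
        have "word_eq R (i # up j) (up j @ [i])"
          by (rule word_eq_commute1) (use 4 i j q R_far in \<open>auto simp: up_def\<close>)
        then show ?thesis unfolding perm using 4 i j q c_up[of j]
          by (intro conjI bexI[of _ "[i]"]) (auto simp: X_def)
      next
        case 5
        then have "word_eq R (i # up j) (up j @ [i - 1])"
          using i j by (intro slide_up) auto
        then show ?thesis unfolding perm using 5 i j q c_up[of j]
          by (intro conjI bexI[of _ "[i - 1]"]) (auto simp: X_def)
      qed
    qed
    have step_down: "perm_of (?F i) (n + 1 - j) \<in> X \<and>
        (\<exists>u\<in>lists {1..l}. word_eq R (i # c (n + 1 - j)) (c (perm_of (?F i) (n + 1 - j)) @ u))"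
      if j: "1 \<le> j" "j \<le> q" and i: "i \<in> {1..q}" for i j
    proof -
      have perm: "perm_of (?F i) (n + 1 - j) =
        (if i = j + 1 then n - j else if i = j then (if j = 1 then n + 1 else n + 2 - j) else n + 1 - j)"
        by (rule perm_mirrored_lower) (use i j q in auto)
      have ex: ?thesis if "perm_of (?F i) (n + 1 - j) = n + 1 - j" "u \<in> lists {1..l}"
        "word_eq R (i # down j) (down j @ u)" for u
        using that c_down[OF j] j q by (auto simp: X_def)
      have slide_one: "word_eq R (k # [1..<Suc q]) ([1..<Suc q] @ [k - 1])" if "3 \<le> k" "k \<le> q" for k
        using slide_up[of 0 k] that by (simp add: up_def)
      consider "i = j + 1" | "i = j" "j = 1" | "i = j" "j \<ge> 2" | "i > j + 1" | "2 \<le> i" "i < j" | "i = 1" "i < j"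
        using i j by fastforce
      then show ?thesis
      proof cases
        case 1
        then have "i # down j = down (j + 1)" using down_Suc[of j] j by simp
        moreover have "n + 1 - (j + 1) = n - j" by simp
        ultimately show ?thesis unfolding perm using 1 i j q c_down[of j] c_down[of "j + 1"]
          by (intro conjI bexI[of _ "[]"]) (auto simp: X_def word_eq.refl)
      next
        case 2
        then have "i # down j = 1 # 1 # up 1" using down_1 by simp
        moreover have "word_eq R \<dots> (up 1)" by (rule square_eq) (use n in auto)
        ultimately show ?thesis unfolding perm using 2 i j q c_down[of j] c_up[of 1]
          by (intro conjI bexI[of _ "[]"]) (auto simp: X_def)
      next
        case 3
        then have "i # down j = i # i # down (j - 1)" using down_Suc[of "j - 1"] by simp
        moreover have "word_eq R \<dots> (down (j - 1))" by (rule square_eq) (use i q in auto)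
        moreover have "n + 1 - (j - 1) = n + 2 - j" using 3 by simp
        ultimately show ?thesis unfolding perm using 3 i j q c_down[of j] c_down[of "j - 1"]
          by (intro conjI bexI[of _ "[]"]) (auto simp: X_def)
      next
        case 4
        have "word_eq R ((i # rev [2..<Suc j]) @ [1..<Suc q]) ((rev [2..<Suc j] @ [i]) @ [1..<Suc q])"
          by (rule word_eq_append[OF word_eq_commute1 word_eq.refl]) (use 4 i q R_far in auto)
        also have "\<dots> = rev [2..<Suc j] @ (i # [1..<Suc q])" by simp
        also have "word_eq R \<dots> (rev [2..<Suc j] @ ([1..<Suc q] @ [i - 1]))"
          by (rule word_eq_append[OF word_eq.refl slide_one]) (use 4 i j in auto)
        finally show ?thesis
          using 4 i j perm by (intro ex[of "[i - 1]"]) (auto simp: down_def q(3) simp del: upt_Suc)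
      next
        case 5
        have "word_eq R ((i # rev [2..<Suc j]) @ [1..<Suc q]) ((rev [2..<Suc j] @ [Suc i]) @ [1..<Suc q])"
          by (rule word_eq_append[OF slide_descending word_eq.refl]) (use 5 i j q R_far R_near(2)[of i] in auto)
        also have "\<dots> = rev [2..<Suc j] @ (Suc i # [1..<Suc q])" by simp
        also have "word_eq R \<dots> (rev [2..<Suc j] @ ([1..<Suc q] @ [Suc i - 1]))"
          by (rule word_eq_append[OF word_eq.refl slide_one]) (use 5 i j in auto)
        finally show ?thesis
          using 5 i j perm by (intro ex[of "[i]"]) (auto simp: down_def q(3) simp del: upt_Suc)
      next
        case 6
        let ?r = "rev [3..<Suc j]" and ?t = "[3..<Suc q]"
        have down: "down j = ?r @ [2, 1, 2] @ ?t"
          using 6 j by (simp add: down_def upt_conv_Cons eval_nat_numeral del: upt_Suc)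
        have "word_eq R ((1 # ?r) @ [2, 1, 2] @ ?t) ((?r @ [1]) @ [2, 1, 2] @ ?t)"
          by (rule word_eq_append[OF word_eq_commute1 word_eq.refl]) (use j q R_far in auto)
        also have "\<dots> = ?r @ [1, 2, 1, 2] @ ?t" by simp
        also have "word_eq R \<dots> (?r @ [2, 1, 2, 1] @ ?t)"
          by (rule word_eq_context[OF R_double])
        also have "\<dots> = (?r @ [2, 1, 2]) @ (1 # ?t)" by simp
        also have "word_eq R \<dots> ((?r @ [2, 1, 2]) @ (?t @ [1]))"
          by (rule word_eq_append[OF word_eq.refl word_eq_commute1]) (use q R_far in auto)
        finally show ?thesis
          using 6 i j perm by (intro ex[of "[1]"]) (auto simp: down q(3) simp del: upt_Suc)
      qed
    qed
    have step: "perm_of (?F i) x \<in> X \<and> (\<exists>u\<in>lists {1..l}. word_eq R (i # c x) (c (perm_of (?F i) x) @ u))"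
      if x: "x \<in> X" and i: "i \<in> {1..q}" for x i
    proof (cases "n < x")
      case True
      then obtain j where j: "x = n + j" "1 \<le> j" "j \<le> q"
        using x by (intro that[of "x - n"]) (auto simp: X_def)
      show ?thesis unfolding j(1) by (rule step_up[OF j(2,3) i])
    next
      case False
      then obtain j where j: "x = n + 1 - j" "1 \<le> j" "j \<le> q"
        using x q by (intro that[of "n + 1 - x"]) (auto simp: X_def)
      show ?thesis unfolding j(1) by (rule step_down[OF j(2,3) i])
    qed
    have x0: "n + q \<in> X" "c (n + q) = []"
      using q c_up[of q] by (auto simp: X_def up_def)
    have wq: "w \<in> lists {1..q}" using Suc.prems by (simp add: q_def)
    obtain u where "u \<in> lists {1..l}" "word_eq R w u" "action u = id"
      by (rule stabilizer_word[OF step x0 wq Suc.prems(3)])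
    then show ?case using Suc by (blast intro: word_eq.trans Suc_leD)
  qed
  then have "faithful_braid_lift S M s {1..n} ?F (2 * n)"
    by unfold_locales auto
  then show thesis by (rule that)
qed

section \<open>Type I2\<close>

lemma perm_columns:
  "1 \<le> x \<Longrightarrow> perm_of (columns p 1 k) x =
    (if odd x = p then (if x < k then x + 1 else x)
     else (if 2 \<le> x \<and> x \<le> k then x - 1 else x))"
proof (induction k arbitrary: x)
  case 0
  then show ?case by (simp add: columns_def)
next
  case (Suc k)
  show ?case
  proof (cases "1 \<le> k \<and> odd k = p")
    case True
    then have c: "columns p 1 (Suc k) = columns p 1 k @ [k]" by (simp add: columns_def)
    consider "x = k" | "x = Suc k" | "x \<noteq> k" "x \<noteq> Suc k" by blast
    then show ?thesis
    proof cases
      case 1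
      then show ?thesis using True Suc.IH[of "Suc k"] unfolding c by auto
    next
      case 2
      then show ?thesis using True Suc.IH[of k] unfolding c by auto
    next
      case 3
      then show ?thesis using Suc.IH[OF Suc.prems] unfolding c by (auto simp: transpose_apply_other)
    qed
  next
    case False
    then have c: "columns p 1 (Suc k) = columns p 1 k" by (auto simp: columns_def)
    consider "x = k" | "x = Suc k" | "x \<noteq> k" "x \<noteq> Suc k" by blast
    then show ?thesis
      using False Suc.IH[OF Suc.prems] Suc.prems unfolding c by cases auto
  qed
qed

lemma alt_upt: "map odd [a..<a + k] = alt k (odd a) (even a)"
proof (induction k arbitrary: a)
  case (Suc k)
  have "[a..<a + Suc k] = a # [Suc a..<Suc a + k]" by (simp add: upt_conv_Cons del: upt_Suc)
  then show ?case using Suc[of "Suc a"] by simp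
qed simp

lemma alt_rev_upt: "map odd (rev [a..<a + k]) = alt k (even (a + k)) (odd (a + k))"
  by (induction k) auto

lemma bipartite_concat:
  "concat (map (\<lambda>p. columns p 1 k @ [k + 1]) (map odd xs)) \<approx>
    concat (map (\<lambda>j. columns (odd j) 1 k) xs) @ replicate (length xs) (k + 1)"
proof (induction xs)
  case (Cons j xs)
  let ?C = "concat (map (\<lambda>j. columns (odd j) 1 k) xs)" and ?r = "replicate (length xs) (k + 1)"
  have "concat (map (\<lambda>p. columns p 1 k @ [k + 1]) (map odd (j # xs))) =
      (columns (odd j) 1 k @ [k + 1]) @ concat (map (\<lambda>p. columns p 1 k @ [k + 1]) (map odd xs))"
    by simp
  also have "\<dots> \<approx> (columns (odd j) 1 k @ [k + 1]) @ ?C @ ?r"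
    by (rule word_eq_append[OF word_eq.refl Cons.IH])
  also have "\<dots> = columns (odd j) 1 k @ [k + 1] @ ?C @ ?r" by simp
  also have "\<dots> \<approx> columns (odd j) 1 k @ ?C @ [k + 1] @ ?r"
    by (rule braid_commute_pair) (auto simp: set_columns)
  finally show ?case by simp
qed (simp add: word_eq.refl)

lemma bipartite_alternating:
  "concat (map (\<lambda>p. columns p 1 k @ [k + 1]) (alt k True False)) \<approx>
    concat (map (\<lambda>p. columns p 1 k @ [k + 1]) (alt k False True))"
proof -
  let ?F = "\<lambda>p. columns p 1 k @ [k + 1]"
  have a: "alt k True False = map odd [1..<Suc k]" "alt k False True = map odd [0..<k]"
    using alt_upt[of 1 k] alt_upt[of 0 k] by (simp_all del: upt_Suc)
  have "concat (map ?F (alt k True False)) \<approx>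
      concat (map (\<lambda>j. columns (odd j) 1 k) [1..<Suc k]) @ replicate k (k + 1)"
    using bipartite_concat[of k "[1..<Suc k]"] unfolding a(1) by (simp del: upt_Suc)
  also have "\<dots> \<approx> concat (map (\<lambda>j. columns (odd j) 1 k) [0..<k]) @ replicate k (k + 1)"
    by (rule word_eq_append[OF alternating_rows word_eq.refl])
  also have "\<dots> \<approx> concat (map ?F (alt k False True))"
    using word_eq.sym[OF bipartite_concat[of k "[0..<k]"]] unfolding a(2) by simp
  finally show ?thesis .
qed

text \<open>The generators are named by the parity of their columns. On the points \<open>1..k\<close> they act as the
  dihedral group acts on the line of points obtained by folding a regular \<open>2k\<close>-gon: alternating
  generators carry \<open>1\<close> to \<open>2\<close>, \<open>3\<close>, \<open>\<dots>\<close>, \<open>k\<close>. The stabilizer of the point \<open>1\<close> is generated by the even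
  generator, and that this generator acts nontrivially also for \<open>k = 2\<close> is seen on the two extra
  points.\<close>

lemma type_I2_lift:
  assumes k: "2 \<le> k" and "coxeter_type_I2 k S M"
  obtains s :: "bool \<Rightarrow> 'a" and I F m where "faithful_braid_lift S M s I F m"
proof -
  obtain s1 s2 where M: "coxeter_matrix S M" and S: "s1 \<noteq> s2" "S = {s1, s2}" "M s1 s2 = enat k"
    using assms unfolding coxeter_type_I2_def by blast
  define s where "s = (\<lambda>p. if p then s1 else s2)"
  let ?F = "\<lambda>p. columns p 1 k @ [k + 1]"
  have order: "M (s p) (s q) = enat k" if "p \<noteq> q" for p q
  proof -
    have "M s2 s1 = M s1 s2" using M S(2) unfolding coxeter_matrix_def by blast
    then show ?thesis using S(3) that by (auto simp: s_def)
  qed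
  interpret braid_lift S M s UNIV ?F "k + 2"
  proof
    show "bij_betw s UNIV S" using S by (auto simp: s_def bij_betw_def inj_on_def UNIV_bool)
    fix p
    show "?F p \<in> lists {1..<k + 2}" by (auto simp: set_columns)
    show "perm_of (?F p) (perm_of (?F p) x) = x" for x
      by (rule far_word_involution)
        (use sorted_columns[of p 1 k] in \<open>auto simp: sorted_wrt_append set_columns\<close>)
    fix q l assume q: "p \<noteq> q" "M (s p) (s q) = enat l"
    then have "l = k" using order[OF q(1)] by simp
    moreover have "p = True \<and> q = False \<or> p = False \<and> q = True" using q(1) by auto
    ultimately show "concat (map ?F (alt l p q)) \<approx> concat (map ?F (alt l q p))"
      by (elim disjE conjE) (simp_all only: bipartite_alternating word_eq.sym[OF bipartite_alternating])
  qed (rule M)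
  have perm_low: "perm_of (?F p) x = (if odd x = p then (if x < k then x + 1 else x)
     else (if 2 \<le> x then x - 1 else x))" if "x \<in> {1..k}" for p x
  proof -
    have "transpose (k + 1) (k + 1 + 1) x = x" using that by (intro transpose_apply_other) auto
    then have "perm_of (?F p) x = perm_of (columns p 1 k) x" by simp
    then show ?thesis using perm_columns[of x p k] that by auto
  qed
  have perm_high: "perm_of (?F False) (k + 1) = k + 2" "perm_of (?F False) (k + 2) = k + 1"
    using perm_columns[of "k + 1" False k] perm_columns[of "k + 2" False k] by simp_all
  have "word_eq R w []" if w: "w \<in> lists UNIV" "action w = id" for w
  proof -
    define c where "c = (\<lambda>x::nat. map odd (rev [1..<x]))"
    have c_Suc: "c (Suc x) = odd x # c x" if "1 \<le> x" for x
      using that by (simp add: c_def)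
    have step: "perm_of (?F p) x \<in> {1..k} \<and>
        (\<exists>u\<in>lists {False}. word_eq R (p # c x) (c (perm_of (?F p) x) @ u))"
      if x: "x \<in> {1..k}" for x p
    proof -
      note perm = perm_low[OF x]
      have "1 \<le> x" "x \<le> k" using x by auto
      then consider "odd x = p" "x < k" | "odd x = p" "x = k" | "odd x \<noteq> p" "2 \<le> x"
        | "odd x \<noteq> p" "x = 1" by linarith
      then show ?thesis
      proof cases
        case 1
        then have "p # c x = c (x + 1)" using c_Suc x by simp
        then show ?thesis unfolding perm using 1 x
          by (intro conjI bexI[of _ "[]"]) (auto simp: word_eq.refl)
      next
        case 2
        \<comment> \<open>At the last point the word becomes alternating with \<open>k\<close> letters; the relation of
          order \<open>k\<close> replaces it by the one ending in the even generator.\<close>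
        have "p # c x = map odd (rev [1..<1 + k])"
          using 2 k by (simp add: c_def)
        also have "\<dots> = alt k (even (1 + k)) (odd (1 + k))" by (rule alt_rev_upt)
        also have "word_eq R \<dots> (alt k (odd (1 + k)) (even (1 + k)))"
          by (rule alt_eq) (simp_all add: order)
        also have "\<dots> = map odd (rev [0..<0 + k])"
          unfolding alt_rev_upt by simp
        also have "\<dots> = c k @ [False]" using k by (simp add: c_def upt_conv_Cons)
        finally show ?thesis unfolding perm using 2 x
          by (intro conjI bexI[of _ "[False]"]) auto
      next
        case 3
        then obtain y where y: "x = Suc y" "1 \<le> y" by (cases x) auto
        then have "p # c x = p # p # c y" using c_Suc[of y] 3 by simp
        moreover have "word_eq R \<dots> (c y)" by (rule square_eq) simp
        ultimately show ?thesis unfolding perm using 3 x y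
          by (intro conjI bexI[of _ "[]"]) auto
      next
        case 4
        then have "p = False" by simp
        then show ?thesis unfolding perm using 4 x
          by (intro conjI bexI[of _ "[False]"]) (auto simp: c_def word_eq.refl)
      qed
    qed
    have "1 \<in> {1..k}" "c 1 = []" using k by (auto simp: c_def)
    from stabilizer_word[OF step this w] obtain u
      where u: "u \<in> lists {False}" "word_eq R w u" "action u = id" by blast
    define d where "d = (\<lambda>x. if x = k + 1 then [] else [False])"
    have step': "perm_of (?F p) x \<in> {k + 1, k + 2} \<and>
        (\<exists>v\<in>lists {}. word_eq R (p # d x) (d (perm_of (?F p) x) @ v))"
      if x: "x \<in> {k + 1, k + 2}" and p: "p \<in> {False}" for x p
    proof -
      have p0: "p = False" using p by simp
      have sq: "word_eq R [False, False] []" by (rule square_eq) simp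
      from x consider "x = k + 1" | "x = k + 2" by blast
      then show ?thesis
      proof cases
        case 1
        show ?thesis unfolding p0 1 perm_high
          by (intro conjI bexI[of _ "[]"]) (simp_all add: d_def word_eq.refl)
      next
        case 2
        show ?thesis unfolding p0 2 perm_high
          using sq by (intro conjI bexI[of _ "[]"]) (simp_all add: d_def)
      qed
    qed
    have "k + 1 \<in> {k + 1, k + 2}" "d (k + 1) = []" by (auto simp: d_def)
    from stabilizer_word[OF step' this u(1,3)] obtain v
      where "v \<in> lists {}" "word_eq R u v" by blast
    then have "word_eq R u []" by simp
    with u(2) show ?thesis by (rule word_eq.trans)
  qed
  then have "faithful_braid_lift S M s UNIV ?F (k + 2)"
    by unfold_locales auto
  then show thesis by (rule that)
qed

theorem mainTheorem1:
  fixes S :: "'a set" and M :: "'a \<Rightarrow> 'a \<Rightarrow> enat"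
  assumes "(\<exists>n\<ge>1. coxeter_type_A n S M) \<or> (\<exists>n\<ge>2. coxeter_type_B n S M) \<or>
    (\<exists>k\<ge>2. coxeter_type_I2 k S M)"
  shows "\<exists>m e f.
    e \<in> mon (coxeter_group S M) (sym_group m) \<and>
    f \<in> hom (braid_group S M) (artin_group m) \<and>
    restrict f (carrier (pure_braid_group S M)) \<in> hom (pure_braid_group S M) (pure_artin_group m) \<and>
    short_exact (pure_braid_group S M) id (braid_group S M) (braid_proj S M) (coxeter_group S M) \<and>
    short_exact (pure_artin_group m) id (artin_group m) (artin_proj m) (sym_group m) \<and>
    (\<forall>x\<in>carrier (braid_group S M). artin_proj m (f x) = e (braid_proj S M x))"
  using assms
proof (elim disjE exE conjE)
  fix n assume "coxeter_type_A n S M"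
  then show ?thesis by (rule type_A_lift) (rule faithful_braid_lift.diagram)
next
  fix n :: nat assume "2 \<le> n" "coxeter_type_B n S M"
  then show ?thesis by (rule type_B_lift) (rule faithful_braid_lift.diagram)
next
  fix k :: nat assume "2 \<le> k" "coxeter_type_I2 k S M"
  then show ?thesis by (rule type_I2_lift) (rule faithful_braid_lift.diagram)
qed

end
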